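(* Let $\mathcal H$ be a complex, separable, infinite-dimensional Hilbert space. A bounded linear operator $T \in \mathcal B(\mathcal H)$ is a product of two quasi-nilpotent operators in $\mathcal B(\mathcal H)$ (that is, $T = Q_1 Q_2$ with $Q_1, Q_2 \in \mathcal B(\mathcal H)$ quasi-nilpotent) if and only if $T$ is not a semi-Fredholm operator.
   Context: $\mathcal B(\mathcal H)$ denotes the algebra of all bounded linear operators on $\mathcal H$. An operator $Q \in \mathcal B(\mathcal H)$ is quasi-nilpotent if its spectrum is $\{0\}$, equivalently $\lim_{n\to\infty}\|Q^n\|^{1/n}=0$. An operator $T$ is upper semi-Fredholm if its range $T(\mathcal H)$ is closed and $\dim \ker T < \infty$; it is lower semi-Fredholm if $\operatorname{codim} T(\mathcal H) < \infty$ (then the range is automatically closed). $T$ is semi-Fredholm if it is upper semi-Fredholm or lower semi-Fredholm. *)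

theory Defs
  imports "HOL-Analysis.Analysis"
begin

text \<open>
  Complex Hilbert spaces, as a type class over the library's Banach spaces. The inner product is
  linear in its first argument. Positivity and definiteness of the inner product are contained in
  \<open>cinner_self\<close>, which says that the norm (and hence the metric and the topology) is the one
  induced by the inner product.
\<close>

class chilbert_space = banach +
  fixes scaleC :: "complex \<Rightarrow> 'a \<Rightarrow> 'a"  (infixr \<open>*\<^sub>C\<close> 75)
    and cinner :: "'a \<Rightarrow> 'a \<Rightarrow> complex"
  assumes scaleC_add_right: "c *\<^sub>C (x + y) = c *\<^sub>C x + c *\<^sub>C y"
    and scaleC_add_left: "(c + d) *\<^sub>C x = c *\<^sub>C x + d *\<^sub>C x"
    and scaleC_scaleC: "c *\<^sub>C d *\<^sub>C x = (c * d) *\<^sub>C x"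
    and scaleC_of_real: "complex_of_real r *\<^sub>C x = r *\<^sub>R x"
    and cinner_add_left: "cinner (x + y) z = cinner x z + cinner y z"
    and cinner_scaleC_left: "cinner (c *\<^sub>C x) y = c * cinner x y"
    and cinner_commute: "cinner x y = cnj (cinner y x)"
    and cinner_self: "cinner x x = complex_of_real ((norm x)\<^sup>2)"

lemma scaleC_one: "1 *\<^sub>C x = (x :: 'a :: chilbert_space)"
  using scaleC_of_real[of 1 x] by simp

global_interpretation complex_vector:
  vector_space "scaleC :: complex \<Rightarrow> 'a \<Rightarrow> 'a :: chilbert_space"
  by unfold_locales (simp_all add: scaleC_add_right scaleC_add_left scaleC_scaleC scaleC_one)

text \<open>
  Membership in the algebra of bounded operators. The library's \<open>bounded_linear\<close> is only
  real-linear, so complex linearity is required separately.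
\<close>

definition bounded_clinear :: "('a :: chilbert_space \<Rightarrow> 'a) \<Rightarrow> bool" where
  "bounded_clinear T \<longleftrightarrow>
     bounded_linear T \<and> Vector_Spaces.linear scaleC scaleC T"

definition invertible_op :: "('a :: chilbert_space \<Rightarrow> 'a) \<Rightarrow> bool" where
  "invertible_op T \<longleftrightarrow> (\<exists>S. bounded_clinear S \<and> S \<circ> T = id \<and> T \<circ> S = id)"

definition spectrum_op :: "('a :: chilbert_space \<Rightarrow> 'a) \<Rightarrow> complex set" where
  "spectrum_op T = {c. \<not> invertible_op (\<lambda>x. T x - c *\<^sub>C x)}"

definition quasinilpotent :: "('a :: chilbert_space \<Rightarrow> 'a) \<Rightarrow> bool" where
  "quasinilpotent Q \<longleftrightarrow> bounded_clinear Q \<and> spectrum_op Q = {0}"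

text \<open>
  Dimensions are over the complex numbers. Since \<open>dim\<close> of an infinite-dimensional space is \<open>0\<close> in
  the library, finiteness of a dimension is expressed by a finite spanning set. The second predicate
  says this for the quotient by the subspace \<open>M\<close>: the cosets of finitely many vectors span it.
\<close>

definition finite_cdim :: "'a :: chilbert_space set \<Rightarrow> bool" where
  "finite_cdim M \<longleftrightarrow> (\<exists>B. finite B \<and> complex_vector.span B = M)"

definition finite_ccodim :: "'a :: chilbert_space set \<Rightarrow> bool" where
  "finite_ccodim M \<longleftrightarrow> (\<exists>B. finite B \<and> (\<forall>x. \<exists>b \<in> complex_vector.span B. x - b \<in> M))"

definition upper_semi_Fredholm :: "('a :: chilbert_space \<Rightarrow> 'a) \<Rightarrow> bool" where
  "upper_semi_Fredholm T \<longleftrightarrow>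
     bounded_clinear T \<and> closed (range T) \<and> finite_cdim {x. T x = 0}"

definition lower_semi_Fredholm :: "('a :: chilbert_space \<Rightarrow> 'a) \<Rightarrow> bool" where
  "lower_semi_Fredholm T \<longleftrightarrow> bounded_clinear T \<and> finite_ccodim (range T)"

definition semi_Fredholm :: "('a :: chilbert_space \<Rightarrow> 'a) \<Rightarrow> bool" where
  "semi_Fredholm T \<longleftrightarrow> upper_semi_Fredholm T \<or> lower_semi_Fredholm T"

end

theory Submission
  imports Defs "HOL-Complex_Analysis.Cauchy_Integral_Formula"
begin

text \<open>
  Call an operator cofinitely bounded below if it is bounded below on the orthogonal complement of a
  finite set. \<open>T\<close> is upper (lower) semi-Fredholm iff \<open>T\<close> (its adjoint \<open>T*\<close>) is cofinitely bounded
  below, and a quasi-nilpotent operator \<open>Q\<close> is never so: if \<open>Q\<close> were bounded below by \<open>c\<close> on a space of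
  finite codimension, then so would be \<open>Q ^ n\<close> by \<open>c ^ n\<close>. Since both properties pass from \<open>Q1 Q2\<close> to
  \<open>Q2\<close> and from \<open>(Q1 Q2)*\<close> to \<open>Q1*\<close>, a product of two quasi-nilpotents is not semi-Fredholm.

  If \<open>T\<close> is not semi-Fredholm, interleave three sequences into an orthonormal basis: unit vectors
  \<open>e n\<close> with \<open>T (e n)\<close> very small, unit vectors \<open>f n\<close> with \<open>T* (f n)\<close> very small, both orthogonal to
  all earlier vectors and to their images under \<open>T\<close> and \<open>T*\<close>, and vectors \<open>m n\<close> (possibly \<open>0\<close>) that
  absorb a dense sequence by Gram-Schmidt. With \<open>\<delta> n = 1 / n!\<close> put
  \<open>Q2: m n \<mapsto> f n, f n \<mapsto> e (2n), e n \<mapsto> \<delta> n e (2n+1)\<close> and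
  \<open>Q1: f n \<mapsto> T (m n), e (2n) \<mapsto> T (f n), e (2n+1) \<mapsto> T (e n) / \<delta> n\<close>, with \<open>Q1 (m n) = 0\<close>.
  Then \<open>T = Q1 Q2\<close>, and modulo the \<open>m\<close>'s both are strictly triangular with rapidly decaying entries,
  so that their powers decay faster than any geometric sequence.
\<close>

section \<open>Complex Hilbert spaces and adjoints\<close>

text \<open>The difficulty lies with the \<open>m n\<close>: nothing makes \<open>T (m n)\<close>
  small, yet a quasi-nilpotent factor must produce it. Since \<open>Q1\<close> kills the
  \<open>m\<close>'s, all that further powers of \<open>Q1\<close> see of \<open>T (m n)\<close> are
  its coordinates at \<open>e j\<close> and \<open>f j\<close> with \<open>j < n\<close>, the later
  vectors being orthogonal to it. So \<open>Q1\<close> goes down the staircase and \<open>Q2\<close>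
  goes up. Going up is harmless only with weights, since the map from \<open>e n\<close> to
  \<open>e (2n+1)\<close> alone is isometric; this is the reason for \<open>\<delta> n\<close>.
  \<open>Q1\<close> has to undo the weight by \<open>1 / \<delta> n\<close>, which is affordable
  because \<open>T (e n)\<close> is of size \<open>(\<delta> n)\<^sup>2\<close>. Going down, decay
  comes from the smallness of \<open>cadjoint T (f n)\<close>: it forces the coordinates at
  \<open>f n\<close> of everything in \<open>range T\<close> to decay. Thus the \<open>e\<close>'s
  use that \<open>T\<close> is not upper semi-Fredholm, and the \<open>f\<close>'s that it is not
  lower semi-Fredholm. The two Fredholm equivalences are closed range arguments. Uniform boundedness
  makes \<open>cadjoint T\<close> bounded below, and a contraction solves the coercive equations by
  which one returns to \<open>T\<close>.\<close>

lemma cinner_add_right: "cinner x (y + z) = cinner x y + cinner x (z :: 'a :: chilbert_space)"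
  by (metis cinner_add_left cinner_commute complex_cnj_add)

lemma cinner_scaleC_right: "cinner x (c *\<^sub>C y) = cnj c * cinner x (y :: 'a :: chilbert_space)"
  by (metis cinner_commute cinner_scaleC_left complex_cnj_mult)

lemma cinner_zero_left [simp]: "cinner 0 (y :: 'a :: chilbert_space) = 0"
  using cinner_add_left[of 0 0 y] by simp

lemma cinner_zero_right [simp]: "cinner (y :: 'a :: chilbert_space) 0 = 0"
  using cinner_add_right[of y 0 0] by simp

lemma cinner_minus_left: "cinner (- x) (y :: 'a :: chilbert_space) = - cinner x y"
  using cinner_add_left[of x "- x" y] by (simp add: eq_neg_iff_add_eq_0 add.commute)

lemma cinner_minus_right: "cinner x (- y :: 'a :: chilbert_space) = - cinner x y"
  using cinner_add_right[of x y "- y"] by (simp add: eq_neg_iff_add_eq_0 add.commute)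

lemma cinner_diff_left: "cinner (x - y) (z :: 'a :: chilbert_space) = cinner x z - cinner y z"
  using cinner_add_left[of x "- y" z] by (simp add: cinner_minus_left)

lemma cinner_diff_right: "cinner z (x - y :: 'a :: chilbert_space) = cinner z x - cinner z y"
  using cinner_add_right[of z x "- y"] by (simp add: cinner_minus_right)

lemma cinner_scaleR_left: "cinner (r *\<^sub>R x) (y :: 'a :: chilbert_space) = of_real r * cinner x y"
  by (metis cinner_scaleC_left scaleC_of_real)

lemma cinner_scaleR_right: "cinner x (r *\<^sub>R y :: 'a :: chilbert_space) = of_real r * cinner x y"
  by (metis cinner_scaleC_right complex_cnj_complex_of_real scaleC_of_real)

lemmas cinner_simps = cinner_add_left cinner_add_right cinner_diff_left cinner_diff_right
  cinner_minus_left cinner_minus_right cinner_scaleC_left cinner_scaleC_right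
  cinner_scaleR_left cinner_scaleR_right

lemma cinner_sum_left:
  "cinner (sum f A) (y :: 'a :: chilbert_space) = (\<Sum>i\<in>A. cinner (f i) y)"
  by (induction A rule: infinite_finite_induct) (auto simp: cinner_add_left)

lemma cinner_eq_zero_swap: "cinner x y = 0 \<longleftrightarrow> cinner y (x :: 'a :: chilbert_space) = 0"
  by (metis cinner_commute complex_cnj_zero)

lemma norm_add_sq:
  "(norm (x + y :: 'a :: chilbert_space))\<^sup>2 = (norm x)\<^sup>2 + 2 * Re (cinner x y) + (norm y)\<^sup>2"
proof -
  have "cinner (x + y) (x + y) = cinner x x + (cinner x y + cnj (cinner x y)) + cinner y y"
    using cinner_commute[of y x] by (simp add: cinner_simps)
  then have "Re (cinner (x + y) (x + y)) = Re (cinner x x + (cinner x y + cnj (cinner x y)) + cinner y y)"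
    by simp
  then show ?thesis
    by (simp add: cinner_self del: of_real_power)
qed

lemma parallelogram:
  "(norm (x + y :: 'a :: chilbert_space))\<^sup>2 + (norm (x - y))\<^sup>2 = 2 * (norm x)\<^sup>2 + 2 * (norm y)\<^sup>2"
  using norm_add_sq[of x y] norm_add_sq[of x "- y"] by (simp add: cinner_simps)

lemma norm_scaleC: "norm (c *\<^sub>C x :: 'a :: chilbert_space) = norm c * norm x"
proof -
  have "cinner (c *\<^sub>C x) (c *\<^sub>C x) = (c * cnj c) * cinner x x"
    by (simp add: cinner_simps)
  then have "complex_of_real ((norm (c *\<^sub>C x))\<^sup>2) = complex_of_real ((norm c)\<^sup>2 * (norm x)\<^sup>2)"
    by (simp only: cinner_self of_real_mult complex_norm_square[of c])
  then have "(norm (c *\<^sub>C x))\<^sup>2 = (norm c * norm x)\<^sup>2"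
    by (simp only: of_real_eq_iff power_mult_distrib)
  then show ?thesis
    by (simp add: power2_eq_iff_nonneg)
qed

lemma cauchy_schwarz: "norm (cinner x y) \<le> norm x * norm (y :: 'a :: chilbert_space)"
proof (cases "y = 0")
  case False
  define c where "c = cinner x y / of_real ((norm y)\<^sup>2)"
  have y: "(norm y)\<^sup>2 > 0"
    using False by simp
  have "cinner x (c *\<^sub>C y) = of_real ((norm (cinner x y))\<^sup>2 / (norm y)\<^sup>2)"
    unfolding c_def cinner_scaleC_right
    by (simp add: complex_norm_square mult.commute del: of_real_power)
  then have "0 \<le> (norm x)\<^sup>2 - 2 * ((norm (cinner x y))\<^sup>2 / (norm y)\<^sup>2) + (norm (c *\<^sub>C y))\<^sup>2"
    using norm_add_sq[of x "- (c *\<^sub>C y)"] zero_le_power2[of "norm (x - c *\<^sub>C y)"]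
    by (simp add: cinner_simps del: zero_le_power2)
  also have "(norm (c *\<^sub>C y))\<^sup>2 = (norm (cinner x y))\<^sup>2 / (norm y)\<^sup>2"
  proof -
    have "norm c = norm (cinner x y) / (norm y)\<^sup>2"
      by (simp add: c_def norm_divide norm_power)
    then show ?thesis
      using y by (simp add: norm_scaleC field_simps power2_eq_square)
  qed
  finally have "(norm (cinner x y))\<^sup>2 / (norm y)\<^sup>2 \<le> (norm x)\<^sup>2"
    by simp
  then have "(norm (cinner x y))\<^sup>2 \<le> (norm x * norm y)\<^sup>2"
    using y by (simp add: divide_simps power_mult_distrib)
  then show ?thesis
    by (rule power2_le_imp_le) simp
qed simp

lemma bounded_bilinear_cinner:
  "bounded_bilinear (cinner :: 'a :: chilbert_space \<Rightarrow> 'a \<Rightarrow> complex)"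
  by (standard, auto simp: cinner_simps scaleR_conv_of_real intro!: exI[of _ 1] cauchy_schwarz)

lemma bounded_bilinear_scaleC:
  "bounded_bilinear (scaleC :: complex \<Rightarrow> 'a \<Rightarrow> 'a :: chilbert_space)"
proof
  show "(r *\<^sub>R a) *\<^sub>C b = r *\<^sub>R a *\<^sub>C (b :: 'a)" for r a b
    by (metis scaleC_of_real scaleC_scaleC scaleR_conv_of_real)
  show "a *\<^sub>C r *\<^sub>R b = r *\<^sub>R a *\<^sub>C (b :: 'a)" for r a b
    by (metis mult.commute scaleC_of_real scaleC_scaleC)
qed (auto simp: scaleC_add_left scaleC_add_right norm_scaleC intro!: exI[of _ 1])

lemmas tendsto_cinner = bounded_bilinear.tendsto[OF bounded_bilinear_cinner]
lemmas tendsto_scaleC = bounded_bilinear.tendsto[OF bounded_bilinear_scaleC]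
lemmas bounded_linear_cinner_left = bounded_bilinear.bounded_linear_left[OF bounded_bilinear_cinner]

lemma cinner_self_zero: "cinner x x = 0 \<longleftrightarrow> x = (0 :: 'a :: chilbert_space)"
  by (simp add: cinner_self)

section \<open>Bounded complex-linear operators\<close>

lemma bounded_clinearI:
  assumes "\<And>x y. T (x + y) = T x + T y" "\<And>c x. T (c *\<^sub>C x) = c *\<^sub>C T x"
    and "\<And>x. norm (T x) \<le> B * norm x"
  shows "bounded_clinear (T :: 'a :: chilbert_space \<Rightarrow> 'a)"
  unfolding bounded_clinear_def
proof
  show "bounded_linear T"
  proof (rule bounded_linear_intro)
    show "T (r *\<^sub>R x) = r *\<^sub>R T x" for r x
      using assms(2)[of "of_real r" x] by (simp add: scaleC_of_real)
    show "norm (T x) \<le> norm x * B" for x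
      using assms(3)[of x] by (simp add: mult.commute)
  qed (rule assms)
  show "Vector_Spaces.linear scaleC scaleC T"
    by unfold_locales (auto simp: assms)
qed

lemma
  assumes "bounded_clinear (T :: 'a :: chilbert_space \<Rightarrow> 'a)"
  shows bounded_clinear_bounded_linear: "bounded_linear T"
    and bounded_clinear_add: "T (x + y) = T x + T y"
    and bounded_clinear_scaleC: "T (c *\<^sub>C x) = c *\<^sub>C T x"
    and bounded_clinear_diff: "T (x - y) = T x - T y"
    and bounded_clinear_zero: "T 0 = 0"
    and bounded_clinear_sum: "T (sum g A) = (\<Sum>i\<in>A. T (g i))"
proof -
  show *: "bounded_linear T"
    using assms by (simp add: bounded_clinear_def)
  show "T (x + y) = T x + T y" "T (x - y) = T x - T y" "T 0 = 0"
    using * by (simp_all add: bounded_linear.linear linear_add linear_diff linear_0)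
  show "T (c *\<^sub>C x) = c *\<^sub>C T x"
    using assms by (simp add: bounded_clinear_def Vector_Spaces.linear_iff)
  show "T (sum g A) = (\<Sum>i\<in>A. T (g i))"
    using * by (simp add: bounded_linear.linear linear_sum)
qed

lemma bounded_clinear_bound:
  assumes "bounded_clinear (T :: 'a :: chilbert_space \<Rightarrow> 'a)"
  obtains B where "B > 0" "\<And>x. norm (T x) \<le> B * norm x"
  using bounded_linear.pos_bounded[OF bounded_clinear_bounded_linear[OF assms]]
  by (metis mult.commute)

lemma bounded_clinear_id: "bounded_clinear (\<lambda>x. x :: 'a :: chilbert_space)"
  by (rule bounded_clinearI[of _ 1]) auto

lemma bounded_clinear_compose:
  assumes "bounded_clinear S" "bounded_clinear (T :: 'a :: chilbert_space \<Rightarrow> 'a)"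
  shows "bounded_clinear (\<lambda>x. S (T x))"
proof -
  obtain A B where A: "A > 0" "\<And>x. norm (S x) \<le> A * norm x" and B: "\<And>x. norm (T x) \<le> B * norm x"
    using assms bounded_clinear_bound by metis
  show ?thesis
  proof (rule bounded_clinearI)
    fix x
    show "norm (S (T x)) \<le> (A * B) * norm x"
      using order_trans[OF A(2)[of "T x"] mult_left_mono[OF B[of x], of A]] A(1) by (simp add: mult.assoc)
  qed (auto simp: assms bounded_clinear_add bounded_clinear_scaleC)
qed

lemma bounded_clinear_plus:
  assumes "bounded_clinear S" "bounded_clinear (T :: 'a :: chilbert_space \<Rightarrow> 'a)"
  shows "bounded_clinear (\<lambda>x. S x + T x)"
proof -
  obtain A B where A: "\<And>x. norm (S x) \<le> A * norm x" and B: "\<And>x. norm (T x) \<le> B * norm x"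
    using assms bounded_clinear_bound by metis
  show ?thesis
  proof (rule bounded_clinearI)
    fix x
    show "norm (S x + T x) \<le> (A + B) * norm x"
      using norm_triangle_ineq[of "S x" "T x"] A[of x] B[of x] by (simp add: algebra_simps)
  qed (auto simp: assms bounded_clinear_add bounded_clinear_scaleC scaleC_add_right)
qed

lemma bounded_clinear_scale:
  assumes "bounded_clinear (T :: 'a :: chilbert_space \<Rightarrow> 'a)"
  shows "bounded_clinear (\<lambda>x. c *\<^sub>C T x)"
proof -
  obtain B where B: "\<And>x. norm (T x) \<le> B * norm x"
    using assms bounded_clinear_bound by metis
  show ?thesis
  proof (rule bounded_clinearI)
    fix x
    show "norm (c *\<^sub>C T x) \<le> (norm c * B) * norm x"
      using mult_left_mono[OF B[of x], of "norm c"] by (simp add: norm_scaleC mult.assoc)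
  qed (auto simp: assms bounded_clinear_add bounded_clinear_scaleC scaleC_add_right scaleC_scaleC mult.commute)
qed

lemma bounded_clinear_funpow:
  assumes "bounded_clinear (T :: 'a :: chilbert_space \<Rightarrow> 'a)"
  shows "bounded_clinear (T ^^ n)"
proof (induction n)
  case 0
  show ?case
    using bounded_clinear_id by (simp add: id_def)
next
  case (Suc n)
  then show ?case
    using bounded_clinear_compose[OF assms Suc] by (simp add: o_def)
qed

lemma norm_funpow_le:
  fixes T :: "'a :: real_normed_vector \<Rightarrow> 'a"
  assumes "\<And>x. norm (T x) \<le> B * norm x" "B \<ge> 0"
  shows "norm ((T ^^ n) x) \<le> B ^ n * norm x"
proof (induction n)
  case (Suc n)
  have "norm (T ((T ^^ n) x)) \<le> B * norm ((T ^^ n) x)"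
    by (rule assms)
  also have "\<dots> \<le> B * (B ^ n * norm x)"
    using Suc assms(2) by (rule mult_left_mono)
  finally show ?case
    by simp
qed simp

text \<open>The representing vector minimizes \<open>(norm x)\<^sup>2 - 2 * \<phi> x\<close>.\<close>
lemma riesz_real:
  assumes "bounded_linear (\<phi> :: 'a :: chilbert_space \<Rightarrow> real)"
  obtains z where "\<And>x. \<phi> x = Re (cinner x z)"
proof -
  interpret bounded_linear \<phi>
    by fact
  obtain K where K: "\<And>x. norm (\<phi> x) \<le> norm x * K"
    using bounded by blast
  define J where "J x = (norm x)\<^sup>2 - 2 * \<phi> x" for x
  have J_lower: "J x \<ge> - K\<^sup>2" for x
  proof -
    have "2 * \<phi> x \<le> 2 * (norm x * K)"
      using K[of x] by simp
    moreover have "0 \<le> (norm x - K)\<^sup>2"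
      by simp
    ultimately show ?thesis
      by (simp add: J_def power2_diff)
  qed
  have bdd: "bdd_below (range J)"
    using J_lower by (auto simp: bdd_below_def)
  define d where "d n = inverse (real (Suc n))" for n
  define I where "I = Inf (range J)"
  have I_le: "I \<le> J x" for x
    unfolding I_def using bdd by (simp add: cINF_lower)
  \<comment> \<open>The value of \<open>J\<close> at the midpoint and the parallelogram law show
    that two near-minimizers are close, so a minimizing sequence is Cauchy.\<close>
  have mid: "(norm (x - y))\<^sup>2 \<le> 2 * (J x - I) + 2 * (J y - I)" for x y
  proof -
    have "J ((1 / 2) *\<^sub>R (x + y)) = (norm (x + y))\<^sup>2 / 4 - \<phi> x - \<phi> y"
      by (simp only: J_def norm_scaleR scale add power_mult_distrib) (simp add: field_simps power2_eq_square)
    then show ?thesis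
      using I_le[of "(1 / 2) *\<^sub>R (x + y)"] parallelogram[of x y] by (simp add: J_def)
  qed
  have "\<exists>x. J x < I + d n" for n
  proof -
    have "Inf (range J) < I + d n"
      using I_def by (simp add: d_def)
    then show ?thesis
      using cInf_lessD[of "range J"] by auto
  qed
  then obtain x where x: "\<And>n. J (x n) < I + d n"
    by metis
  have "Cauchy x"
  proof (rule metric_CauchyI)
    fix e :: real
    assume "e > 0"
    then obtain N where N: "d N < e\<^sup>2 / 4"
      using reals_Archimedean[of "e\<^sup>2 / 4"] by (auto simp: d_def)
    have "dist (x m) (x n) < e" if "m \<ge> N" "n \<ge> N" for m n
    proof -
      have "d m \<le> d N" "d n \<le> d N"
        using that by (auto simp: d_def intro!: le_imp_inverse_le)
      then have "2 * (J (x m) - I) + 2 * (J (x n) - I) < 4 * d N"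
        using x[of m] x[of n] by (simp add: algebra_simps)
      then have "(norm (x m - x n))\<^sup>2 < e\<^sup>2"
        using mid[of "x m" "x n"] N by simp
      then show ?thesis
        using \<open>e > 0\<close> by (simp add: dist_norm power_less_imp_less_base)
    qed
    then show "\<exists>M. \<forall>m\<ge>M. \<forall>n\<ge>M. dist (x m) (x n) < e"
      by blast
  qed
  then obtain z where z: "x \<longlonglongrightarrow> z"
    using Cauchy_convergent convergent_def by blast
  have "(\<lambda>n. J (x n)) \<longlonglongrightarrow> J z"
    unfolding J_def by (intro tendsto_intros z tendsto)
  moreover have "(\<lambda>n. I + d n) \<longlonglongrightarrow> I + 0"
    unfolding d_def by (intro tendsto_intros LIMSEQ_inverse_real_of_nat)
  ultimately have "J z \<le> I + 0"
    by (rule LIMSEQ_le) (use x less_imp_le in blast)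
  then have min: "J z \<le> J y" for y
    using I_le[of y] by linarith
  have "\<phi> h = Re (cinner h z)" for h
  proof -
    define d where "d = Re (cinner z h) - \<phi> h"
    have nonneg: "0 \<le> 2 * t * d + t\<^sup>2 * (norm h)\<^sup>2" for t
      using min[of "z + t *\<^sub>R h"] norm_add_sq[of z "t *\<^sub>R h"]
      by (simp add: J_def d_def add scale cinner_simps power_mult_distrib algebra_simps)
    \<comment> \<open>The best choice of \<open>t\<close> would be
      \<open>- d / (norm h)\<^sup>2\<close>; adding 1 to the denominator covers
      \<open>h = 0\<close>.\<close>
    define s where "s = (norm h)\<^sup>2 + 1"
    have s: "s > 0" "(norm h)\<^sup>2 \<le> s"
      by (auto simp: s_def add_nonneg_pos)
    have "0 \<le> 2 * (- d / s) * d + (- d / s)\<^sup>2 * s"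
      using nonneg[of "- d / s"] mult_left_mono[OF s(2), of "(- d / s)\<^sup>2"] by simp
    also have "\<dots> = - (d * d) / s"
      using s by (simp add: field_simps power2_eq_square)
    finally have "0 \<le> - (d * d) / s" .
    then have "d * d \<le> 0"
      using s(1) by (simp add: field_simps)
    then have "d = 0"
      using zero_le_square[of d] by (metis antisym mult_eq_0_iff)
    then show ?thesis
      using cinner_commute[of h z] by (simp add: d_def)
  qed
  then show ?thesis
    using that by blast
qed

text \<open>A complex-linear functional is determined by its real part, because
  \<open>Re (\<phi> (\<i> *\<^sub>C x)) = - Im (\<phi> x)\<close>.\<close>

lemma riesz:
  assumes "bounded_linear (\<phi> :: 'a :: chilbert_space \<Rightarrow> complex)"
    and "\<And>c x. \<phi> (c *\<^sub>C x) = c * \<phi> x"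
  obtains z where "\<And>x. \<phi> x = cinner x z"
proof -
  obtain z where z: "\<And>x. Re (\<phi> x) = Re (cinner x z)"
    using riesz_real[OF bounded_linear_compose[OF bounded_linear_Re assms(1)]] by blast
  have "Im (\<phi> x) = Im (cinner x z)" for x
    using z[of "\<i> *\<^sub>C x"] by (simp add: assms(2) cinner_simps)
  then show ?thesis
    using that[of z] z by (simp add: complex_eq_iff)
qed

definition cadjoint :: "('a :: chilbert_space \<Rightarrow> 'a) \<Rightarrow> 'a \<Rightarrow> 'a" where
  "cadjoint T y = (SOME z. \<forall>x. cinner (T x) y = cinner x z)"

lemma cadjoint:
  assumes "bounded_clinear T"
  shows "cinner (T x) y = cinner x (cadjoint T y)"
proof -
  have "bounded_linear (\<lambda>x. cinner (T x) y)"
    using bounded_linear_compose[OF bounded_linear_cinner_left bounded_clinear_bounded_linear[OF assms]] .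
  then obtain z where "\<And>x. cinner (T x) y = cinner x z"
    using riesz[of "\<lambda>x. cinner (T x) y"]
    by (metis assms bounded_clinear_scaleC cinner_scaleC_left)
  then have "\<forall>x. cinner (T x) y = cinner x (cadjoint T y)"
    unfolding cadjoint_def by (intro someI) auto
  then show ?thesis
    by blast
qed

lemma cinner_ext:
  assumes "\<And>x. cinner x y = cinner x z"
  shows "y = (z :: 'a :: chilbert_space)"
proof -
  have "cinner (y - z) (y - z) = 0"
    using assms by (simp add: cinner_diff_right)
  then show ?thesis
    by (simp add: cinner_self_zero)
qed

lemma norm_cadjoint_le:
  assumes "bounded_clinear T" "\<And>x. norm (T x) \<le> B * norm x"
  shows "norm (cadjoint T y) \<le> B * norm y"
proof (cases "cadjoint T y = 0")
  case True
  have "0 \<le> B * norm y"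
    using assms(2)[of y] norm_ge_zero order_trans by blast
  then show ?thesis
    using True by simp
next
  case False
  have "(norm (cadjoint T y))\<^sup>2 = norm (cinner (T (cadjoint T y)) y)"
    by (simp add: cadjoint[OF assms(1)] cinner_self norm_power)
  also have "\<dots> \<le> norm (T (cadjoint T y)) * norm y"
    by (rule cauchy_schwarz)
  also have "\<dots> \<le> B * norm (cadjoint T y) * norm y"
    by (intro mult_right_mono assms) auto
  finally show ?thesis
    using False by (simp add: power2_eq_square)
qed

lemma bounded_clinear_cadjoint:
  assumes "bounded_clinear T"
  shows "bounded_clinear (cadjoint T)"
proof -
  obtain B where B: "\<And>x. norm (T x) \<le> B * norm x"
    using assms bounded_clinear_bound by metis
  show ?thesis
    by (rule bounded_clinearI[OF _ _ norm_cadjoint_le[OF assms B]])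
      (rule cinner_ext, simp add: cinner_simps flip: cadjoint[OF assms])+
qed

lemma cadjoint_compose:
  assumes "bounded_clinear S" "bounded_clinear T"
  shows "cadjoint (S \<circ> T) y = cadjoint T (cadjoint S y)"
proof (rule cinner_ext)
  fix x
  have "bounded_clinear (S \<circ> T)"
    using bounded_clinear_compose[OF assms] by (simp add: o_def)
  then show "cinner x (cadjoint (S \<circ> T) y) = cinner x (cadjoint T (cadjoint S y))"
    by (simp flip: cadjoint add: assms)
qed

lemma cadjoint_funpow:
  assumes "bounded_clinear T"
  shows "cinner ((T ^^ n) x) y = cinner x ((cadjoint T ^^ n) y)"
proof (induction n arbitrary: y)
  case (Suc n)
  show ?case
    using Suc[of "cadjoint T y"] cadjoint[OF assms, of "(T ^^ n) x" y]
    by (simp add: funpow_swap1)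
qed simp

section \<open>Quasi-nilpotency as decay of powers\<close>

text \<open>Spectral radius zero: the n-th roots of the operator norms of \<open>A ^^ n\<close> tend
  to 0. The pointwise form avoids operator norms and lets \<open>D\<close> depend on
  \<open>e\<close>.\<close>

definition power_decay :: "('a :: chilbert_space \<Rightarrow> 'a) \<Rightarrow> bool" where
  "power_decay A \<longleftrightarrow> (\<forall>e>0. \<exists>D. \<forall>n x. norm ((A ^^ n) x) \<le> D * e ^ n * norm x)"

text \<open>The inverse is the Neumann series with terms \<open>- A ^^ n / c ^ Suc n\<close>. Decay
  at rate \<open>norm c / 2\<close> dominates it by a geometric series of ratio 1/2.\<close>

lemma invertible_op_of_power_decay:
  fixes A :: "'a :: chilbert_space \<Rightarrow> 'a"
  assumes A: "bounded_clinear A" and decay: "power_decay A" and c: "c \<noteq> 0"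
  shows "invertible_op (\<lambda>x. A x - c *\<^sub>C x)"
proof -
  obtain D where D: "\<And>n x. norm ((A ^^ n) x) \<le> D * (norm c / 2) ^ n * norm x"
    using decay c unfolding power_decay_def by (metis half_gt_zero zero_less_norm_iff)
  define t where "t n x = (1 / c) ^ Suc n *\<^sub>C (A ^^ n) x" for n x
  have t_le: "norm (t n x) \<le> (D / norm c * norm x) * (1 / 2) ^ n" for n x
  proof -
    have "norm (t n x) \<le> (1 / norm c) ^ Suc n * (D * (norm c / 2) ^ n * norm x)"
      unfolding t_def norm_scaleC norm_power norm_divide norm_one
      by (intro mult_left_mono D) auto
    also have "\<dots> = (D / norm c * norm x) * (1 / 2) ^ n"
      using c by (simp add: field_simps)
    finally show ?thesis .
  qed
  have geo: "summable (\<lambda>n. (D / norm c * norm x) * (1 / 2 :: real) ^ n)" for x :: 'a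
    by (intro summable_mult summable_geometric) auto
  have summ_norm: "summable (\<lambda>n. norm (t n x))" for x
    by (rule summable_comparison_test'[OF geo[of x]]) (simp only: norm_ge_zero real_norm_def abs_of_nonneg t_le)
  have summ: "summable (\<lambda>n. t n x)" for x
    by (rule summable_norm_cancel[OF summ_norm])
  define S where "S x = - (\<Sum>n. t n x)" for x
  have shift: "A (t n x) = c *\<^sub>C t (Suc n) x" "t n (A x) = c *\<^sub>C t (Suc n) x" for n x
    using c by (simp_all add: t_def bounded_clinear_scaleC[OF A] scaleC_scaleC funpow_swap1)
  have scale_suminf: "(\<Sum>n. k *\<^sub>C f n) = k *\<^sub>C (\<Sum>n. f n)" if "summable f" for k and f :: "nat \<Rightarrow> 'a"
    using bounded_linear.suminf[OF bounded_bilinear.bounded_linear_right[OF bounded_bilinear_scaleC] that]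
    by simp
  have t_add: "t n (x + y) = t n x + t n y" for n x y
    using bounded_clinear_add[OF bounded_clinear_funpow[OF A]]
    by (simp add: t_def scaleC_add_right)
  have t_scale: "t n (k *\<^sub>C x) = k *\<^sub>C t n x" for n k x
    using bounded_clinear_scaleC[OF bounded_clinear_funpow[OF A]]
    by (simp add: t_def scaleC_scaleC mult.commute)
  have tele: "c *\<^sub>C (\<Sum>n. t (Suc n) x) - c *\<^sub>C (\<Sum>n. t n x) = - x" for x
  proof -
    have "c *\<^sub>C t 0 x = x"
      using c by (simp add: t_def scaleC_scaleC scaleC_one)
    then show ?thesis
      by (simp add: suminf_split_head[OF summ] complex_vector.scale_right_diff_distrib)
  qed
  have bS: "bounded_clinear S"
  proof (rule bounded_clinearI)
    show "S (x + y) = S x + S y" for x y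
      unfolding S_def t_add suminf_add[OF summ summ, symmetric] by simp
    show "S (k *\<^sub>C x) = k *\<^sub>C S x" for k x
      unfolding S_def t_scale scale_suminf[OF summ] by (simp add: complex_vector.scale_minus_right)
    show "norm (S x) \<le> (2 * D / norm c) * norm x" for x
    proof -
      have "norm (S x) \<le> (\<Sum>n. norm (t n x))"
        by (simp add: S_def summable_norm[OF summ_norm])
      also have "\<dots> \<le> (\<Sum>n. (D / norm c * norm x) * (1 / 2 :: real) ^ n)"
        by (intro suminf_le t_le summ_norm geo)
      also have "\<dots> = (D / norm c * norm x) * 2"
        by (subst suminf_mult) (auto simp: suminf_geometric intro!: summable_geometric)
      finally show ?thesis
        by (simp add: mult_ac)
    qed
  qed
  have sum_Suc: "summable (\<lambda>n. t (Suc n) x)" for x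
    using summable_ignore_initial_segment[OF summ, of 1 x] by simp
  have "A (S x) - c *\<^sub>C S x = x" for x
  proof -
    have "A (\<Sum>n. t n x) = c *\<^sub>C (\<Sum>n. t (Suc n) x)"
      using bounded_linear.suminf[OF bounded_clinear_bounded_linear[OF A] summ]
      by (simp add: shift scale_suminf[OF sum_Suc])
    then have "A (\<Sum>n. t n x) - c *\<^sub>C (\<Sum>n. t n x) = - x"
      using tele by simp
    then show ?thesis
      unfolding S_def using bounded_clinear_diff[OF A, of 0] bounded_clinear_zero[OF A]
      by (simp add: complex_vector.scale_minus_right) (metis add.inverse_inverse minus_diff_eq uminus_add_conv_diff)
  qed
  moreover have "S (A x - c *\<^sub>C x) = x" for x
  proof -
    have "S (A x) = - (c *\<^sub>C (\<Sum>n. t (Suc n) x))"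
      unfolding S_def shift by (simp add: scale_suminf[OF sum_Suc])
    moreover have "S (c *\<^sub>C x) = - (c *\<^sub>C (\<Sum>n. t n x))"
      using bounded_clinear_scaleC[OF bS] by (simp add: S_def complex_vector.scale_minus_right)
    ultimately have "S (A x - c *\<^sub>C x) = - (c *\<^sub>C (\<Sum>n. t (Suc n) x) - c *\<^sub>C (\<Sum>n. t n x))"
      unfolding bounded_clinear_diff[OF bS] by simp
    then show ?thesis
      unfolding tele by simp
  qed
  ultimately show ?thesis
    unfolding invertible_op_def using bS by (auto simp: fun_eq_iff intro!: exI[of _ S])
qed

lemma powers_of_two_unbounded:
  assumes "\<And>n. 2 ^ n \<le> (D :: real)"
  shows False
proof -
  obtain n where "D < 2 ^ n"
    using real_arch_pow[of 2 D] by auto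
  then show False
    using assms[of n] by simp
qed

text \<open>The spectrum must also contain 0. A bounded inverse \<open>S\<close> with bound
  \<open>B\<close> would give \<open>x = (S ^^ n) ((A ^^ n) x)\<close>, which decay at rate
  \<open>1 / (2 * B)\<close> forbids as soon as there is a nonzero vector.\<close>

lemma quasinilpotentI:
  fixes A :: "'a :: chilbert_space \<Rightarrow> 'a"
  assumes A: "bounded_clinear A" and decay: "power_decay A" and v: "(v :: 'a) \<noteq> 0"
  shows "quasinilpotent A"
proof -
  have "\<not> invertible_op A"
  proof
    assume "invertible_op A"
    then obtain S where S: "bounded_clinear S" "S \<circ> A = id"
      by (auto simp: invertible_op_def)
    obtain B where B: "B > 0" "\<And>x. norm (S x) \<le> B * norm x"
      using S(1) bounded_clinear_bound by metis
    obtain D where D: "\<And>n x. norm ((A ^^ n) x) \<le> D * (1 / (2 * B)) ^ n * norm x"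
      using decay B(1) unfolding power_decay_def
      by (metis mult_pos_pos zero_less_divide_1_iff zero_less_numeral)
    have inv: "(S ^^ n) ((A ^^ n) x) = x" for n x
    proof (induction n)
      case (Suc n)
      have "(S ^^ Suc n) ((A ^^ Suc n) x) = (S ^^ n) ((S \<circ> A) ((A ^^ n) x))"
        by (simp add: funpow_swap1)
      then show ?case
        using Suc S(2) by simp
    qed simp
    have "2 ^ n \<le> D" for n
    proof -
      have "norm v \<le> B ^ n * norm ((A ^^ n) v)"
        using norm_funpow_le[of S B n "(A ^^ n) v"] B by (simp add: inv)
      also have "\<dots> \<le> B ^ n * (D * (1 / (2 * B)) ^ n * norm v)"
        using B(1) by (intro mult_left_mono D) auto
      also have "\<dots> = (D / 2 ^ n) * norm v"
        using B(1) by (simp add: field_simps)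
      finally show ?thesis
        using v by (simp add: field_simps)
    qed
    then show False
      by (rule powers_of_two_unbounded)
  qed
  then have "spectrum_op A = {0}"
    using invertible_op_of_power_decay[OF A decay] by (auto simp: spectrum_op_def)
  then show ?thesis
    using A by (simp add: quasinilpotent_def)
qed

text \<open>
  Writing \<open>R z\<close> for the inverse of \<open>1 - z A\<close>, the functions \<open>A\<^sup>n R z\<close> are entire with value \<open>A\<^sup>n\<close> at
  \<open>0\<close>, and \<open>z A\<^sup>n\<^sup>+\<^sup>1 R z = A\<^sup>n (R z - 1)\<close>. Hence the maximum principle on the circle of radius \<open>r\<close>
  loses only a factor \<open>2 / r\<close> from one power to the next, and no Taylor coefficients are needed.
\<close>
lemma quasinilpotent_power_decay:
  fixes A :: "'a :: chilbert_space \<Rightarrow> 'a"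
  assumes "quasinilpotent A"
  shows "power_decay A"
proof -
  have A: "bounded_clinear A" and spec: "spectrum_op A = {0}"
    using assms by (auto simp: quasinilpotent_def)
  have "\<exists>R. bounded_clinear R \<and> (\<forall>x. R (x - z *\<^sub>C A x) = x) \<and> (\<forall>x. R x - z *\<^sub>C A (R x) = x)" for z
  proof (cases "z = 0")
    case True
    then show ?thesis
      using bounded_clinear_id by (intro exI[of _ "\<lambda>x. x"]) simp
  next
    case False
    then have "1 / z \<notin> spectrum_op A"
      using spec by simp
    then have "invertible_op (\<lambda>x. A x - (1 / z) *\<^sub>C x)"
      unfolding spectrum_op_def by blast
    then obtain S where S: "bounded_clinear S" "\<And>x. S (A x - (1 / z) *\<^sub>C x) = x"
      "\<And>x. A (S x) - (1 / z) *\<^sub>C S x = x"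
      by (auto simp: invertible_op_def fun_eq_iff)
    define R where "R x = (- 1 / z) *\<^sub>C S x" for x
    have "bounded_clinear R"
      unfolding R_def using S(1) by (rule bounded_clinear_scale)
    moreover have "R (x - z *\<^sub>C A x) = x" for x
    proof -
      have "R (x - z *\<^sub>C A x) = S ((- 1 / z) *\<^sub>C (x - z *\<^sub>C A x))"
        by (simp only: R_def bounded_clinear_scaleC[OF S(1)])
      also have "(- 1 / z) *\<^sub>C (x - z *\<^sub>C A x) = A x - (1 / z) *\<^sub>C x"
      proof -
        have "(- 1 / z) *\<^sub>C (x - z *\<^sub>C A x) = (- 1 / z) *\<^sub>C x - (- 1 / z * z) *\<^sub>C A x"
          by (simp only: complex_vector.scale_right_diff_distrib scaleC_scaleC)
        also have "\<dots> = - ((1 / z) *\<^sub>C x) + A x"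
          using False by (simp add: scaleC_one)
        finally show ?thesis
          by simp
      qed
      finally show ?thesis
        using S(2) by simp
    qed
    moreover have "R x - z *\<^sub>C A (R x) = x" for x
    proof -
      have "R x - z *\<^sub>C A (R x) = A (S x) - (1 / z) *\<^sub>C S x"
      proof -
        have "R x - z *\<^sub>C A (R x) = (- 1 / z) *\<^sub>C S x - (z * (- 1 / z)) *\<^sub>C A (S x)"
          by (simp only: R_def bounded_clinear_scaleC[OF A] scaleC_scaleC)
        then show ?thesis
          using False by (simp add: scaleC_one)
      qed
      then show ?thesis
        using S(3) by simp
    qed
    ultimately show ?thesis
      by blast
  qed
  then obtain R where R: "\<And>z. bounded_clinear (R z)" "\<And>z x. R z (x - z *\<^sub>C A x) = x"
    "\<And>z x. R z x - z *\<^sub>C A (R z x) = x"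
    by metis
  have R0: "R 0 x = x" for x
    using R(2)[of 0 x] by simp
  have resolvent: "R z x = R w x + (z - w) *\<^sub>C R w (A (R z x))" for z w x
  proof -
    have "R z x - w *\<^sub>C A (R z x) = x + (z - w) *\<^sub>C A (R z x)"
      using R(3)[of z x] by (simp add: complex_vector.scale_left_diff_distrib algebra_simps)
    then have "R z x = R w (x + (z - w) *\<^sub>C A (R z x))"
      using R(2)[of w "R z x"] by simp
    then show ?thesis
      using R(1)[of w] by (simp add: bounded_clinear_add bounded_clinear_scaleC)
  qed
  obtain a where a: "a > 0" "\<And>x. norm (A x) \<le> a * norm x"
    using A bounded_clinear_bound by metis
  have "\<exists>B. B > 0 \<and> (\<forall>x. norm (R w x) \<le> B * norm x)" for w
    using R(1)[of w] bounded_clinear_bound by metis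
  then obtain B where B: "\<And>w. B w > 0" "\<And>w x. norm (R w x) \<le> B w * norm x"
    by metis
  \<comment> \<open>With this radius \<open>d w * (B w * a) = 1 / 2\<close>, so on the ball around
    \<open>w\<close> the last term of the resolvent identity can be absorbed into the left
    side.\<close>
  define d where "d w = 1 / (2 * (B w * a))" for w
  have d: "d w > 0" for w
    using a B(1)[of w] by (simp add: d_def)
  have RA_le: "norm (R w (A x)) \<le> (B w * a) * norm x" for w x
  proof -
    have "norm (R w (A x)) \<le> B w * norm (A x)"
      by (rule B)
    also have "\<dots> \<le> B w * (a * norm x)"
      using B(1)[of w] by (intro mult_left_mono a) auto
    finally show ?thesis
      by simp
  qed
  have loc: "norm (R z x) \<le> 2 * B w * norm x" if "z \<in> ball w (d w)" for z w x
  proof -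
    have zw: "norm (z - w) \<le> d w"
      using that by (simp add: dist_norm norm_minus_commute)
    have "norm (R z x) \<le> norm (R w x) + norm (z - w) * norm (R w (A (R z x)))"
      using norm_triangle_ineq[of "R w x" "(z - w) *\<^sub>C R w (A (R z x))"]
      by (simp add: norm_scaleC flip: resolvent)
    also have "\<dots> \<le> B w * norm x + d w * ((B w * a) * norm (R z x))"
      using d[of w] by (intro add_mono mult_mono B RA_le zw) auto
    also have "d w * ((B w * a) * norm (R z x)) = norm (R z x) / 2"
      using a(1) B(1)[of w] by (simp add: d_def)
    finally show ?thesis
      by simp
  qed
  have cont: "((\<lambda>z. R z x) \<longlongrightarrow> R w x) (at w)" for w x
  proof -
    have "\<forall>\<^sub>F z in at w. norm (R z x - R w x) \<le> norm (z - w) * ((B w * a) * (2 * B w * norm x))"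
    proof -
      have "\<forall>\<^sub>F z in at w. z \<in> ball w (d w)"
        using d[of w] by (intro eventually_at_in_open') auto
      then show ?thesis
      proof eventually_elim
        case (elim z)
        have "R z x - R w x = (z - w) *\<^sub>C R w (A (R z x))"
          using resolvent[of z x w] by (metis add_diff_cancel_left')
        then have "norm (R z x - R w x) = norm (z - w) * norm (R w (A (R z x)))"
          by (simp add: norm_scaleC)
        also have "\<dots> \<le> norm (z - w) * ((B w * a) * norm (R z x))"
          by (intro mult_left_mono RA_le) auto
        also have "\<dots> \<le> norm (z - w) * ((B w * a) * (2 * B w * norm x))"
          using a(1) B(1)[of w] by (intro mult_left_mono loc[OF elim]) auto
        finally show ?case .
      qed
    qed
    moreover have "((\<lambda>z. norm (z - w) * ((B w * a) * (2 * B w * norm x))) \<longlongrightarrow> 0) (at w)"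
    proof -
      have "((\<lambda>z. norm (z - w) * ((B w * a) * (2 * B w * norm x)))
        \<longlongrightarrow> norm (w - w) * ((B w * a) * (2 * B w * norm x))) (at w)"
        by (intro tendsto_intros)
      then show ?thesis
        by simp
    qed
    ultimately have "((\<lambda>z. R z x - R w x) \<longlongrightarrow> 0) (at w)"
      by (rule Lim_null_comparison)
    then show ?thesis
      by (rule LIM_zero_cancel)
  qed
  have deriv: "((\<lambda>z. cinner (L (R z x)) y) has_field_derivative cinner (L (R w (A (R w x)))) y) (at w)"
    if L: "bounded_clinear L" for L x y w
  proof -
    have "bounded_clinear (\<lambda>x. L (R w (A x)))"
      using bounded_clinear_compose[OF L bounded_clinear_compose[OF R(1) A]] .
    then have "((\<lambda>z. cinner (L (R w (A (R z x)))) y) \<longlongrightarrow> cinner (L (R w (A (R w x)))) y) (at w)"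
      using bounded_linear.tendsto[OF bounded_clinear_bounded_linear cont]
      by (intro tendsto_cinner tendsto_const)
    moreover have "\<forall>\<^sub>F z in at w. cinner (L (R w (A (R z x)))) y
        = (cinner (L (R z x)) y - cinner (L (R w x)) y) / (z - w)"
    proof -
      have "cinner (L (R w (A (R z x)))) y = (cinner (L (R z x)) y - cinner (L (R w x)) y) / (z - w)"
        if "z \<noteq> w" for z
      proof -
        have "cinner (L (R z x)) y = cinner (L (R w x)) y + (z - w) * cinner (L (R w (A (R z x)))) y"
          by (subst resolvent[of z x w])
            (simp add: bounded_clinear_add[OF L] bounded_clinear_scaleC[OF L] cinner_simps)
        then show ?thesis
          using that by (simp add: field_simps)
      qed
      then show ?thesis
        by (auto simp: eventually_at_filter)
    qed
    ultimately show ?thesis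
      unfolding has_field_derivative_iff by (rule Lim_transform_eventually)
  qed
  show ?thesis
    unfolding power_decay_def
  proof (intro allI impI)
    fix e :: real
    assume e: "e > 0"
    \<comment> \<open>The factor \<open>2 / r\<close> lost per power becomes
      \<open>e\<close>.\<close>
    define r where "r = 2 / e"
    have r: "r > 0"
      using e by (simp add: r_def)
    obtain W where W: "W \<subseteq> sphere 0 r" "finite W" "sphere 0 r \<subseteq> (\<Union>w\<in>W. ball w (d w))"
    proof (rule compactE_image[of "sphere 0 r" "sphere 0 r" "\<lambda>w. ball w (d w)"])
      show "sphere 0 r \<subseteq> (\<Union>w\<in>sphere 0 r. ball w (d w))"
        using d by (auto intro!: bexI)
    qed auto
    \<comment> \<open>The circle is covered by finitely many balls on which \<open>R\<close> is
      bounded; the sum of their bounds serves as a common one.\<close>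
    define C where "C = (\<Sum>w\<in>W. 2 * B w)"
    have C0: "C \<ge> 0"
      unfolding C_def using B(1) by (intro sum_nonneg) (simp add: less_imp_le)
    have C: "norm (R z x) \<le> C * norm x" if z: "norm z = r" for z x
    proof -
      obtain w where w: "w \<in> W" "z \<in> ball w (d w)"
        using subsetD[OF W(3), of z] z by auto
      have "norm (R z x) \<le> 2 * B w * norm x"
        using loc w by blast
      also have "2 * B w \<le> C"
        unfolding C_def using w(1) W(2) B(1) by (intro member_le_sum) (auto simp: less_imp_le)
      finally show ?thesis
        by (simp add: mult_right_mono)
    qed
    \<comment> \<open>The maximum principle, as Cauchy's inequality for the derivative of order 0 at
      the centre, where \<open>R 0\<close> is the identity. Pairing with \<open>L x\<close> itself
      makes the value there \<open>(norm (L x))\<^sup>2\<close>.\<close>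
    have center: "norm (L x) \<le> M" if L: "bounded_clinear L" and M: "\<And>z. norm z = r \<Longrightarrow> norm (L (R z x)) \<le> M"
      for L x M
    proof -
      let ?f = "\<lambda>z. cinner (L (R z x)) (L x)"
      have "?f holomorphic_on UNIV"
        using deriv[OF L, of x "L x"] by (auto simp: holomorphic_on_open)
      then have "norm ((deriv ^^ 0) ?f 0) \<le> fact 0 * (M * norm (L x)) / r ^ 0"
      proof (intro Cauchy_inequality r)
        show "norm (?f z) \<le> M * norm (L x)" if "norm (0 - z) = r" for z
          using order_trans[OF cauchy_schwarz mult_right_mono[OF M]] that by simp
      qed (auto intro: holomorphic_on_subset holomorphic_on_imp_continuous_on)
      then have "(norm (L x))\<^sup>2 \<le> M * norm (L x)"
        by (simp add: R0 cinner_self norm_power)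
      moreover have "0 \<le> M"
        using M[of "of_real r"] r order_trans[OF norm_ge_zero] by simp
      ultimately show ?thesis
        by (cases "L x = 0") (auto simp: power2_eq_square)
    qed
    have circle: "norm ((A ^^ n) (R z x)) \<le> C * e ^ n * norm x" if "norm z = r" for n z x
      using that
    proof (induction n arbitrary: z)
      case 0
      then show ?case
        using C by simp
    next
      case (Suc n)
      have An: "bounded_clinear (A ^^ n)"
        by (rule bounded_clinear_funpow[OF A])
      have "R z x - x = z *\<^sub>C A (R z x)"
        using R(3)[of z x] by (metis add_diff_cancel_left' diff_add_cancel)
      then have "(A ^^ n) (R z x) - (A ^^ n) x = (A ^^ n) (z *\<^sub>C A (R z x))"
        using bounded_clinear_diff[OF An] by metis
      then have "(A ^^ n) (R z x) - (A ^^ n) x = z *\<^sub>C (A ^^ Suc n) (R z x)"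
        by (simp add: bounded_clinear_scaleC[OF An] funpow_swap1)
      then have "r * norm ((A ^^ Suc n) (R z x)) = norm ((A ^^ n) (R z x) - (A ^^ n) x)"
        using Suc.prems by (simp add: norm_scaleC del: funpow.simps)
      also have "\<dots> \<le> norm ((A ^^ n) (R z x)) + norm ((A ^^ n) x)"
        by (rule norm_triangle_ineq4)
      also have "\<dots> \<le> C * e ^ n * norm x + C * e ^ n * norm x"
        by (intro add_mono Suc.IH Suc.prems center[OF An])
      finally show ?case
        using e by (simp add: r_def field_simps del: funpow.simps)
    qed
    have "norm ((A ^^ n) x) \<le> C * e ^ n * norm x" for n x
      by (rule center[OF bounded_clinear_funpow[OF A] circle])
    then show "\<exists>D. \<forall>n x. norm ((A ^^ n) x) \<le> D * e ^ n * norm x"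
      by blast
  qed
qed

section \<open>Finitely many orthogonality conditions, and lower bounds under them\<close>

text \<open>One more condition lowers the dimension by at most one: any \<open>v\<close> that
  violates it spans the old space together with the new one.\<close>

lemma not_finite_cdim_orthogonal:
  assumes "complex_vector.subspace N" "\<not> finite_cdim N" "finite G"
  shows "\<not> finite_cdim {x \<in> N. \<forall>g\<in>G. cinner x g = 0}"
  using assms(3)
proof induction
  case empty
  then show ?case
    using assms by simp
next
  case (insert g G)
  let ?N = "{x \<in> N. \<forall>g\<in>G. cinner x g = 0}"
  let ?N' = "{x \<in> N. \<forall>g\<in>insert g G. cinner x g = 0}"
  have sub: "complex_vector.subspace ?N"
    using assms(1) by (auto simp: complex_vector.subspace_def cinner_simps)
  show ?case
  proof
    assume "finite_cdim ?N'"
    then obtain B where B: "finite B" "complex_vector.span B = ?N'"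
      by (auto simp: finite_cdim_def)
    show False
    proof (cases "\<exists>v\<in>?N. cinner v g \<noteq> 0")
      case False
      then have "?N' = ?N"
        by auto
      then show False
        using insert B by (auto simp: finite_cdim_def)
    next
      case True
      then obtain v where v: "v \<in> ?N" "cinner v g \<noteq> 0"
        by blast
      have "B \<subseteq> ?N"
        using B(2) complex_vector.span_superset[of B] by auto
      then have "complex_vector.span (insert v B) \<subseteq> ?N"
        using v sub by (intro complex_vector.span_minimal) auto
      moreover have "x \<in> complex_vector.span (insert v B)" if "x \<in> ?N" for x
      proof -
        define k where "k = cinner x g / cinner v g"
        have "x - k *\<^sub>C v \<in> ?N"
          using that v(1) sub
          by (intro complex_vector.subspace_diff complex_vector.subspace_scale)
        then have "x - k *\<^sub>C v \<in> ?N'"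
          using v(2) by (simp add: cinner_simps k_def)
        then show ?thesis
          using B(2) by (auto simp: complex_vector.span_insert)
      qed
      ultimately have "complex_vector.span (insert v B) = ?N"
        by blast
      then show False
        using insert B(1) by (auto simp: finite_cdim_def)
    qed
  qed
qed

lemma exists_orthogonal_vector:
  assumes "complex_vector.subspace N" "\<not> finite_cdim N" "finite G"
  obtains x where "x \<in> N" "x \<noteq> 0" "\<And>g. g \<in> G \<Longrightarrow> cinner x g = 0"
proof -
  let ?M = "{x \<in> N. \<forall>g\<in>G. cinner x g = 0}"
  have "0 \<in> ?M"
    using assms(1) by (simp add: complex_vector.subspace_0)
  moreover have "?M \<noteq> {0}"
    using not_finite_cdim_orthogonal[OF assms] complex_vector.span_empty
    unfolding finite_cdim_def by (metis finite.emptyI)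
  ultimately show ?thesis
    using that by blast
qed

definition cofinitely_bounded_below :: "('a :: chilbert_space \<Rightarrow> 'a) \<Rightarrow> bool" where
  "cofinitely_bounded_below T \<longleftrightarrow>
     (\<exists>G c. finite G \<and> c > 0 \<and> (\<forall>x. (\<forall>g\<in>G. cinner x g = 0) \<longrightarrow> c * norm x \<le> norm (T x)))"

lemma power_decay_cadjoint:
  assumes "bounded_clinear A" "power_decay A"
  shows "power_decay (cadjoint A)"
  unfolding power_decay_def
proof (intro allI impI)
  fix e :: real
  assume "e > 0"
  then obtain D where D: "\<And>n x. norm ((A ^^ n) x) \<le> D * e ^ n * norm x"
    using assms(2) unfolding power_decay_def by metis
  have "(cadjoint A ^^ n) y = cadjoint (A ^^ n) y" for n y
    by (rule cinner_ext) (simp add: cadjoint[OF bounded_clinear_funpow[OF assms(1)], symmetric]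
        cadjoint_funpow[OF assms(1)])
  then have "norm ((cadjoint A ^^ n) x) \<le> D * e ^ n * norm x" for n x
    using norm_cadjoint_le[OF bounded_clinear_funpow[OF assms(1)] D] by simp
  then show "\<exists>D. \<forall>n x. norm ((cadjoint A ^^ n) x) \<le> D * e ^ n * norm x"
    by blast
qed

lemma power_decay_not_cofinitely_bounded_below:
  fixes Q :: "'a :: chilbert_space \<Rightarrow> 'a"
  assumes inf: "\<not> finite_cdim (UNIV :: 'a set)" and Q: "bounded_clinear Q" and decay: "power_decay Q"
  shows "\<not> cofinitely_bounded_below Q"
proof
  assume "cofinitely_bounded_below Q"
  then obtain G c where G: "finite G" "c > 0"
    and lower: "\<And>x. (\<forall>g\<in>G. cinner x g = 0) \<Longrightarrow> c * norm x \<le> norm (Q x)"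
    by (auto simp: cofinitely_bounded_below_def)
  obtain D where D: "\<And>n x. norm ((Q ^^ n) x) \<le> D * (c / 2) ^ n * norm x"
    using decay G(2) unfolding power_decay_def by (metis half_gt_zero)
  have "2 ^ n \<le> D" for n
  proof -
    \<comment> \<open>Orthogonality of \<open>x\<close> to \<open>(cadjoint Q ^^ k) g\<close> is
      orthogonality of \<open>(Q ^^ k) x\<close> to \<open>g\<close>. So the first \<open>n\<close>
      iterates, from \<open>x\<close> on, all stay where the lower bound applies.\<close>
    let ?H = "\<Union>k<n. (cadjoint Q ^^ k) ` G"
    have "finite ?H"
      using G by auto
    then obtain x where x: "x \<noteq> 0" "\<And>h. h \<in> ?H \<Longrightarrow> cinner x h = 0"
      using exists_orthogonal_vector[OF complex_vector.subspace_UNIV inf] by metis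
    have "k \<le> n \<Longrightarrow> c ^ k * norm x \<le> norm ((Q ^^ k) x)" for k
    proof (induction k)
      case (Suc k)
      have "cinner ((Q ^^ k) x) g = 0" if "g \<in> G" for g
      proof -
        have "(cadjoint Q ^^ k) g \<in> ?H"
          using that Suc.prems by auto
        then show ?thesis
          using x(2) by (simp add: cadjoint_funpow[OF Q])
      qed
      then have "c * norm ((Q ^^ k) x) \<le> norm ((Q ^^ Suc k) x)"
        using lower by simp
      moreover have "c * (c ^ k * norm x) \<le> c * norm ((Q ^^ k) x)"
        using Suc G(2) by (intro mult_left_mono) auto
      ultimately show ?case
        by simp
    qed simp
    from this[of n] have "c ^ n * norm x \<le> D * (c / 2) ^ n * norm x"
      using D[of n x] by simp
    then show ?thesis
      using x(1) G(2) by (simp add: field_simps)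
  qed
  then show False
    by (rule powers_of_two_unbounded)
qed

section \<open>Semi-Fredholm operators as operators bounded below\<close>

abbreviation orthogonal_space :: "'a :: chilbert_space set \<Rightarrow> 'a set" where
  "orthogonal_space G \<equiv> {x. \<forall>g\<in>G. cinner x g = 0}"

lemma subspace_orthogonal_space: "complex_vector.subspace (orthogonal_space G)"
  by (auto simp: complex_vector.subspace_def cinner_simps)

lemma closed_orthogonal_space: "closed (orthogonal_space G)"
proof -
  have "closed ((\<lambda>x. cinner x g) -` {0})" for g :: 'a
    by (intro continuous_closed_vimage linear_continuous_at bounded_linear_cinner_left) auto
  moreover have "orthogonal_space G = (\<Inter>g\<in>G. (\<lambda>x. cinner x g) -` {0})"
    by auto
  ultimately show ?thesis
    by (simp add: closed_INT)
qed

lemma cinner_span_eq_zero: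
  assumes "x \<in> orthogonal_space G" "y \<in> complex_vector.span G"
  shows "cinner x y = 0" "cinner y x = 0"
proof -
  have "complex_vector.span G \<subseteq> {y. cinner x y = 0}"
    using assms(1) by (intro complex_vector.span_minimal)
      (auto simp: complex_vector.subspace_def cinner_simps)
  then show "cinner x y = 0"
    using assms(2) by auto
  then show "cinner y x = 0"
    by (simp add: cinner_eq_zero_swap)
qed

lemma subspace_imp_real_subspace:
  assumes "complex_vector.subspace (V :: 'a :: chilbert_space set)"
  shows "subspace V"
proof -
  have "r *\<^sub>R x \<in> V" if "x \<in> V" for r x
    using complex_vector.subspace_scale[OF assms that, of "of_real r"] by (simp add: scaleC_of_real)
  then show ?thesis
    using assms by (auto simp: subspace_def complex_vector.subspace_def)
qed

lemma subspace_image: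
  assumes T: "bounded_clinear T" and V: "complex_vector.subspace V"
  shows "complex_vector.subspace (T ` V)"
  unfolding complex_vector.subspace_def
proof (intro conjI ballI allI)
  show "0 \<in> T ` V"
    using complex_vector.subspace_0[OF V] bounded_clinear_zero[OF T] by (metis image_eqI)
  fix x
  assume "x \<in> T ` V"
  then obtain x' where x': "x' \<in> V" "x = T x'"
    by blast
  show "c *\<^sub>C x \<in> T ` V" for c
    using complex_vector.subspace_scale[OF V x'(1), of c] bounded_clinear_scaleC[OF T, of c x'] x'(2)
    by (metis image_eqI)
  fix y
  assume "y \<in> T ` V"
  then obtain y' where y': "y' \<in> V" "y = T y'"
    by blast
  show "x + y \<in> T ` V"
    using complex_vector.subspace_add[OF V x'(1) y'(1)] bounded_clinear_add[OF T, of x' y'] x'(2) y'(2)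
    by (metis image_eqI)
qed

lemma subspace_range:
  assumes "bounded_clinear T"
  shows "complex_vector.subspace (range T)"
  using subspace_image[OF assms complex_vector.subspace_UNIV] .

lemma subspace_kernel:
  assumes "bounded_clinear T"
  shows "complex_vector.subspace {x. T x = 0}"
  by (auto simp: complex_vector.subspace_def bounded_clinear_add[OF assms]
      bounded_clinear_scaleC[OF assms] bounded_clinear_zero[OF assms])

text \<open>
  A gliding hump: \<open>y n\<close> moves by \<open>3\<^sup>-\<^sup>n\<close> along \<open>\<plusminus> h n\<close>, with the sign that makes \<open>cinner (y (n + 1)) (h n)\<close>
  at least \<open>(4/3)\<^sup>n\<close>, and the later moves change this by at most half.
\<close>
lemma unbounded_functionals_contradiction:
  fixes h :: "nat \<Rightarrow> 'a :: chilbert_space"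
  assumes V: "complex_vector.subspace V" "closed V"
    and h: "\<And>n. h n \<in> V" "\<And>n. norm (h n) = 4 ^ n"
    and bounded: "\<And>x. x \<in> V \<Longrightarrow> \<exists>K. \<forall>n. norm (cinner x (h n)) \<le> K"
  shows False
proof -
  \<comment> \<open>Dividing by \<open>12 ^ n\<close> gives steps of norm
    \<open>4 ^ n / 12 ^ n = (1/3) ^ n\<close>, which are summable, while the pairing with
    \<open>h n\<close> is \<open>16 ^ n / 12 ^ n = (4/3) ^ n\<close>, which is unbounded.\<close>
  define s where "s n = (1 / 12 :: real) ^ n *\<^sub>R h n" for n
  have norm_s: "norm (s n) = (1 / 3) ^ n" for n
    by (simp add: s_def h power_one_over field_simps flip: power_mult_distrib)
  have s_h: "norm (cinner (s n) (h n)) = (4 / 3) ^ n" for n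
  proof -
    have "norm (cinner (s n) (h n)) = (1 / 12) ^ n * (4 ^ n) ^ 2"
      by (simp add: s_def cinner_scaleR_left cinner_self norm_mult norm_power h)
    also have "(4 ^ n)\<^sup>2 = (16 :: real) ^ n"
      by (simp add: power2_eq_square flip: power_mult_distrib)
    finally show ?thesis
      by (simp flip: power_mult_distrib)
  qed
  have "\<exists>t \<in> {s n, - s n}. norm (cinner (y + t) (h n)) \<ge> (4 / 3) ^ n" for y n
  proof (rule ccontr)
    assume "\<not> ?thesis"
    then have "norm (cinner (y + s n) (h n)) + norm (cinner (y - s n) (h n)) < 2 * (4 / 3) ^ n"
      by auto
    moreover have "2 * (4 / 3) ^ n = norm (cinner (y + s n) (h n) - cinner (y - s n) (h n))"
      using s_h[of n] by (simp add: cinner_simps flip: mult_2)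
    ultimately show False
      using norm_triangle_ineq4[of "cinner (y + s n) (h n)" "cinner (y - s n) (h n)"] by simp
  qed
  then have "\<forall>y n. \<exists>t. t \<in> {s n, - s n} \<and> norm (cinner (y + t) (h n)) \<ge> (4 / 3) ^ n"
    by blast
  then obtain t where t: "\<And>y n. t y n \<in> {s n, - s n}"
    "\<And>y n. norm (cinner (y + t y n) (h n)) \<ge> (4 / 3) ^ n"
    unfolding choice_iff by blast
  define y where "y = rec_nat 0 (\<lambda>n y. y + t y n)"
  have y0: "y 0 = 0" and ySuc: "y (Suc n) = y n + t (y n) n" for n
    by (simp_all add: y_def)
  have norm_t: "norm (t z n) = (1 / 3) ^ n" and tV: "t z n \<in> V" for z n
  proof -
    have "s n \<in> V"
      unfolding s_def using subspace_imp_real_subspace[OF V(1)] h(1) by (simp add: subspace_scale)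
    then show "t z n \<in> V"
      using t(1)[of z n] complex_vector.subspace_neg[OF V(1)] by auto
    show "norm (t z n) = (1 / 3) ^ n"
      using t(1)[of z n] norm_s[of n] by auto
  qed
  have yV: "y n \<in> V" for n
    by (induction n) (auto simp: y0 ySuc tV complex_vector.subspace_0[OF V(1)]
        complex_vector.subspace_add[OF V(1)])
  have y_diff: "norm (y (n + k) - y n) \<le> (3 / 2) * ((1 / 3) ^ n - (1 / 3) ^ (n + k))" for n k
  proof (induction k)
    case (Suc k)
    have "norm (y (n + Suc k) - y n) \<le> norm (y (n + k) - y n) + norm (t (y (n + k)) (n + k))"
      using norm_triangle_ineq[of "y (n + k) - y n" "t (y (n + k)) (n + k)"]
      by (simp add: ySuc algebra_simps)
    then show ?case
      using Suc by (simp add: norm_t)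
  qed simp
  have y_diff': "norm (y (n + k) - y n) \<le> (3 / 2) * (1 / 3) ^ n" for n k
    using y_diff[of n k] by (simp add: order_trans)
  have "Cauchy y"
  proof (rule CauchyI')
    fix e :: real
    assume e: "e > 0"
    then obtain N where N: "(1 / 3) ^ N < e / (3 / 2)"
      using real_arch_pow_inv[of "e / (3 / 2)" "1 / 3"] by auto
    have "dist (y m) (y n) < e" if "m \<ge> N" "n > m" for m n
    proof -
      have "dist (y m) (y n) \<le> (3 / 2) * (1 / 3) ^ m"
        using y_diff'[of m "n - m"] that by (simp add: dist_norm norm_minus_commute)
      also have "\<dots> \<le> (3 / 2) * (1 / 3) ^ N"
        using that by (simp add: power_decreasing)
      also have "\<dots> < e"
        using N by simp
      finally show ?thesis .
    qed
    then show "\<exists>M. \<forall>m\<ge>M. \<forall>n>m. dist (y m) (y n) < e"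
      by blast
  qed
  then obtain x where x: "y \<longlonglongrightarrow> x"
    using Cauchy_convergent convergent_def by blast
  have "x \<in> V"
    using closed_sequentially[OF V(2) _ x] yV by blast
  then obtain K where K: "\<And>n. norm (cinner x (h n)) \<le> K"
    using bounded by blast
  have "(4 / 3) ^ n \<le> 2 * K" for n
  proof -
    have "norm (x - y (Suc n)) \<le> (3 / 2) * (1 / 3) ^ Suc n"
    proof (rule LIMSEQ_le_const2)
      show "(\<lambda>k. norm (y (k + Suc n) - y (Suc n))) \<longlonglongrightarrow> norm (x - y (Suc n))"
        by (intro tendsto_intros LIMSEQ_ignore_initial_segment x)
      show "\<exists>N. \<forall>k\<ge>N. norm (y (k + Suc n) - y (Suc n)) \<le> (3 / 2) * (1 / 3) ^ Suc n"
        using y_diff'[of "Suc n"] by (simp add: add.commute)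
    qed
    then have "norm (cinner (x - y (Suc n)) (h n)) \<le> (3 / 2) * (1 / 3) ^ Suc n * 4 ^ n"
      using order_trans[OF cauchy_schwarz mult_right_mono] h(2)
      by (metis norm_ge_zero)
    also have "\<dots> = (1 / 2) * (4 / 3) ^ n"
      by (simp add: power_divide)
    finally have "norm (cinner (x - y (Suc n)) (h n)) \<le> (1 / 2) * (4 / 3) ^ n" .
    moreover have "(4 / 3) ^ n \<le> norm (cinner (y (Suc n)) (h n))"
      using t(2) by (simp add: ySuc)
    moreover have "cinner (y (Suc n)) (h n) = cinner x (h n) - cinner (x - y (Suc n)) (h n)"
      by (simp add: cinner_simps)
    ultimately show ?thesis
      using norm_triangle_ineq4[of "cinner x (h n)" "cinner (x - y (Suc n)) (h n)"] K[of n] by simp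
  qed
  moreover obtain n where "(4 / 3) ^ n > 2 * K"
    using real_arch_pow[of "4 / 3"] by auto
  ultimately show False
    by (metis not_le)
qed

text \<open>The range hypothesis says that \<open>T\<close> followed by the projection to
  \<open>V\<close> is onto \<open>V\<close>. If the conclusion fails, there are \<open>h n\<close>
  in \<open>V\<close> of norm \<open>4 ^ n\<close> with bounded \<open>cadjoint T (h n)\<close>.
  Every \<open>y\<close> in \<open>V\<close> pairs with them as some \<open>T x\<close> does, hence
  boundedly, against the uniform boundedness principle. Both Fredholm equivalences use this, with
  \<open>V\<close> the closed range or the complement of a finite set.\<close>

lemma cadjoint_bounded_below:
  fixes T :: "'a :: chilbert_space \<Rightarrow> 'a"
  assumes T: "bounded_clinear T" and V: "complex_vector.subspace V" "closed V"
    and range: "\<And>y. y \<in> V \<Longrightarrow> \<exists>x. \<forall>f\<in>V. cinner y f = cinner (T x) f"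
  obtains c where "c > 0" "\<And>f. f \<in> V \<Longrightarrow> c * norm f \<le> norm (cadjoint T f)"
proof (rule ccontr)
  assume contra: "\<not> thesis"
  have "\<exists>f\<in>V. norm (cadjoint T f) < (1 / 4) ^ n * norm f" for n :: nat
  proof (rule ccontr)
    assume "\<not> ?thesis"
    then have "thesis"
      by (intro that[of "(1 / 4) ^ n"]) (auto simp: not_less)
    with contra show False ..
  qed
  then obtain f where f: "\<And>n. f n \<in> V" "\<And>n. norm (cadjoint T (f n)) < (1 / 4) ^ n * norm (f n)"
    by metis
  have f0: "norm (f n) > 0" for n
    using f(2)[of n] norm_ge_zero[of "cadjoint T (f n)"]
    by (metis less_le_not_le mult_zero_right norm_zero zero_less_norm_iff)
  define h where "h n = of_real (4 ^ n / norm (f n)) *\<^sub>C f n" for n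
  have hV: "h n \<in> V" for n
    unfolding h_def by (intro complex_vector.subspace_scale V f)
  have norm_h: "norm (h n) = 4 ^ n" for n
    using f0[of n] by (simp add: h_def norm_scaleC norm_divide norm_power)
  have Th: "norm (cadjoint T (h n)) \<le> 1" for n
  proof -
    have "norm (cadjoint T (h n)) = 4 ^ n / norm (f n) * norm (cadjoint T (f n))"
      by (simp add: h_def bounded_clinear_scaleC[OF bounded_clinear_cadjoint[OF T]] norm_scaleC
          norm_divide norm_power)
    also have "\<dots> \<le> 4 ^ n / norm (f n) * ((1 / 4) ^ n * norm (f n))"
      using f(2)[of n] by (intro mult_left_mono) auto
    also have "\<dots> = 1"
      using f0[of n] by (simp add: power_divide)
    finally show ?thesis .
  qed
  show False
  proof (rule unbounded_functionals_contradiction[OF V hV norm_h])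
    fix y
    assume "y \<in> V"
    then obtain x where x: "\<And>f. f \<in> V \<Longrightarrow> cinner y f = cinner (T x) f"
      using range by blast
    have "norm (cinner y (h n)) \<le> norm x" for n
    proof -
      have "cinner y (h n) = cinner x (cadjoint T (h n))"
        using x[OF hV] by (simp add: cadjoint[OF T])
      then have "norm (cinner y (h n)) \<le> norm x * norm (cadjoint T (h n))"
        using cauchy_schwarz by metis
      also have "\<dots> \<le> norm x * 1"
        by (intro mult_left_mono Th) auto
      finally show ?thesis
        by simp
    qed
    then show "\<exists>K. \<forall>n. norm (cinner y (h n)) \<le> K"
      by blast
  qed
qed

text \<open>A solution is a fixed point of \<open>x - t *\<^sub>R (A x - y)\<close>. Coercivity
  bounds the squared contraction factor by \<open>1 - 2 * t * c + t\<^sup>2 * B\<^sup>2\<close>,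
  whose minimum \<open>1 - c\<^sup>2 / B\<^sup>2\<close> is attained at
  \<open>t = c / B\<^sup>2\<close>.\<close>

lemma lax_milgram:
  fixes A :: "'a :: chilbert_space \<Rightarrow> 'a"
  assumes A: "bounded_clinear A" and V: "complex_vector.subspace V" "closed V"
    and AV: "\<And>x. x \<in> V \<Longrightarrow> A x \<in> V" and c: "c > 0"
    and coercive: "\<And>x. x \<in> V \<Longrightarrow> c * (norm x)\<^sup>2 \<le> Re (cinner (A x) x)"
    and y: "y \<in> V"
  obtains x where "x \<in> V" "A x = y"
proof -
  obtain B0 where B0: "\<And>x. norm (A x) \<le> B0 * norm x"
    using A bounded_clinear_bound by metis
  \<comment> \<open>The maximum ensures \<open>c \<le> B\<close>, so that the radicand in
    \<open>k\<close> is not negative.\<close>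
  define B where "B = max B0 c"
  have B: "B \<ge> c" "norm (A x) \<le> B * norm x" for x
    using B0[of x] mult_right_mono[of B0 B "norm x"] by (auto simp: B_def)
  define t where "t = c / B\<^sup>2"
  define k where "k = sqrt (1 - c\<^sup>2 / B\<^sup>2)"
  have B_pos: "B > 0"
    using B(1) c by simp
  have ratio: "0 < c\<^sup>2 / B\<^sup>2" "c\<^sup>2 / B\<^sup>2 \<le> 1"
    using c B_pos B(1) by (auto simp: divide_le_eq power_mono)
  have k: "0 \<le> k" "k < 1" "k\<^sup>2 = 1 - c\<^sup>2 / B\<^sup>2"
    using ratio by (auto simp: k_def)
  define f where "f x = x - t *\<^sub>R (A x - y)" for x
  have contract: "norm (x - t *\<^sub>R A x) \<le> k * norm x" if "x \<in> V" for x
  proof (rule power2_le_imp_le)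
    have t: "t > 0"
      using c B_pos by (simp add: t_def)
    have "(norm (x - t *\<^sub>R A x))\<^sup>2 = (norm x)\<^sup>2 - 2 * t * Re (cinner (A x) x) + t\<^sup>2 * (norm (A x))\<^sup>2"
      using norm_add_sq[of x "- (t *\<^sub>R A x)"] cinner_commute[of x "A x"]
      by (simp add: cinner_simps power_mult_distrib)
    also have "\<dots> \<le> (norm x)\<^sup>2 - 2 * t * (c * (norm x)\<^sup>2) + t\<^sup>2 * (B * norm x)\<^sup>2"
      using coercive[OF that] B(2)[of x] t
      by (intro add_mono diff_mono mult_left_mono power_mono) auto
    also have "\<dots> = (k * norm x)\<^sup>2"
      unfolding power_mult_distrib k(3)
      using B_pos by (simp add: t_def field_simps power2_eq_square)
    finally show "(norm (x - t *\<^sub>R A x))\<^sup>2 \<le> (k * norm x)\<^sup>2" .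
    show "0 \<le> k * norm x"
      using k by simp
  qed
  note rV = subspace_imp_real_subspace[OF V(1)]
  have "\<exists>!x\<in>V. f x = x"
  proof (rule Banach_fix)
    show "complete V"
      using V(2) by (simp add: complete_eq_closed)
    show "V \<noteq> {}"
      using y by auto
    show "f ` V \<subseteq> V"
      using AV y rV by (auto simp: f_def intro!: subspace_diff subspace_scale)
    show "dist (f x) (f z) \<le> k * dist x z" if "x \<in> V" "z \<in> V" for x z
    proof -
      have "f x - f z = (x - z) - t *\<^sub>R A (x - z)"
        by (simp add: f_def bounded_clinear_diff[OF A] algebra_simps)
      then show ?thesis
        using contract[of "x - z"] that rV by (simp add: dist_norm subspace_diff)
    qed
  qed (use k in auto)
  then obtain x where x: "x \<in> V" "f x = x"
    by blast
  then have "A x = y"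
    using c B_pos by (simp add: f_def t_def)
  with x(1) show ?thesis
    by (rule that)
qed

text \<open>If \<open>v\<close> is not in \<open>V\<close>, its distance to \<open>V\<close> is
  positive and controls the coefficient of \<open>v\<close>. Hence the coefficients along a
  convergent sequence converge too.\<close>

lemma closed_subspace_plus_line:
  assumes V: "complex_vector.subspace V" "closed (V :: 'a :: chilbert_space set)"
  shows "closed {x. \<exists>k. x - k *\<^sub>C v \<in> V}" (is "closed ?W")
proof (cases "v \<in> V")
  case True
  have "x - k *\<^sub>C v \<in> V \<longleftrightarrow> x \<in> V" for x k
    using complex_vector.subspace_scale[OF V(1) True, of k]
    by (metis V(1) complex_vector.subspace_add complex_vector.subspace_diff diff_add_cancel)
  then show ?thesis
    using V(2) by simp
next
  case False
  obtain d where d: "d > 0" "\<And>y. y \<in> V \<Longrightarrow> d \<le> norm (v - y)"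
  proof -
    have "open (- V)" "v \<in> - V"
      using V(2) False by auto
    then obtain d where "d > 0" "ball v d \<subseteq> - V"
      by (meson openE)
    then show ?thesis
      by (intro that[of d]) (auto simp: subset_eq dist_norm not_less[symmetric])
  qed
  have coeff: "norm k * d \<le> norm x" if "x - k *\<^sub>C v \<in> V" for x k
  proof (cases "k = 0")
    case False
    have "(1 / k) *\<^sub>C (k *\<^sub>C v - x) \<in> V"
      using that complex_vector.subspace_neg[OF V(1) that]
      by (intro complex_vector.subspace_scale V) simp
    from d(2)[OF this] have "d \<le> norm ((1 / k) *\<^sub>C x)"
      using False by (simp add: complex_vector.scale_right_diff_distrib scaleC_scaleC scaleC_one)
    then show ?thesis
      using False by (simp add: norm_scaleC norm_divide field_simps)
  qed simp
  show ?thesis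
    unfolding closed_sequential_limits
  proof (intro allI impI, elim conjE)
    fix x l
    assume x: "\<forall>n. x n \<in> ?W" and l: "x \<longlonglongrightarrow> l"
    then obtain k where k: "\<And>n. x n - k n *\<^sub>C v \<in> V"
      by auto metis
    have kk: "norm (k m - k n) * d \<le> norm (x m - x n)" for m n
    proof (rule coeff)
      show "x m - x n - (k m - k n) *\<^sub>C v \<in> V"
        using complex_vector.subspace_diff[OF V(1) k[of m] k[of n]]
        by (simp add: complex_vector.scale_left_diff_distrib algebra_simps)
    qed
    have "Cauchy k"
    proof (rule metric_CauchyI)
      fix e :: real
      assume "e > 0"
      then have "e * d > 0"
        using d by simp
      then obtain N where N: "\<And>m n. m \<ge> N \<Longrightarrow> n \<ge> N \<Longrightarrow> dist (x m) (x n) < e * d"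
        using LIMSEQ_imp_Cauchy[OF l] metric_CauchyD by metis
      have "dist (k m) (k n) < e" if "m \<ge> N" "n \<ge> N" for m n
      proof -
        have "dist (k m) (k n) * d < e * d"
          using N[OF that] kk[of m n] by (simp add: dist_norm)
        then show ?thesis
          using d(1) by simp
      qed
      then show "\<exists>M. \<forall>m\<ge>M. \<forall>n\<ge>M. dist (k m) (k n) < e"
        by blast
    qed
    then obtain k' where "k \<longlonglongrightarrow> k'"
      using Cauchy_convergent convergent_def by blast
    then have "(\<lambda>n. x n - k n *\<^sub>C v) \<longlonglongrightarrow> l - k' *\<^sub>C v"
      by (intro tendsto_diff l tendsto_scaleC tendsto_const)
    then have "l - k' *\<^sub>C v \<in> V"
      using closed_sequentially[OF V(2), of "\<lambda>n. x n - k n *\<^sub>C v"] k by blast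
    then show "l \<in> ?W"
      by blast
  qed
qed

text \<open>Dropping one condition \<open>g\<close> enlarges the image by at most the line through
  \<open>T v\<close>, which preserves closedness; this is repeated until no condition is
  left.\<close>

lemma closed_range_of_closed_orthogonal_image:
  assumes T: "bounded_clinear T" and "finite G" "closed (T ` orthogonal_space G)"
  shows "closed (range T)"
  using assms(2,3)
proof (induction)
  case empty
  then show ?case
    by simp
next
  case (insert g G)
  let ?N = "orthogonal_space G" and ?N' = "orthogonal_space (insert g G)"
  show ?case
  proof (cases "\<exists>v\<in>?N. cinner v g \<noteq> 0")
    case False
    then have "?N' = ?N"
      by auto
    then show ?thesis
      using insert by simp
  next
    case True
    then obtain v where v: "v \<in> ?N" "cinner v g \<noteq> 0"
      by blast
    have sub: "complex_vector.subspace (T ` ?N')"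
      by (rule subspace_image[OF T subspace_orthogonal_space])
    have "T ` ?N = {y. \<exists>k. y - k *\<^sub>C T v \<in> T ` ?N'}"
    proof (intro equalityI subsetI)
      fix y
      assume "y \<in> T ` ?N"
      then obtain x where x: "x \<in> ?N" "y = T x"
        by blast
      have "x - (cinner x g / cinner v g) *\<^sub>C v \<in> ?N'"
        using x(1) v by (simp add: cinner_simps)
      from imageI[OF this, of T] have "y - (cinner x g / cinner v g) *\<^sub>C T v \<in> T ` ?N'"
        by (simp only: x(2) bounded_clinear_diff[OF T] bounded_clinear_scaleC[OF T])
      then show "y \<in> {y. \<exists>k. y - k *\<^sub>C T v \<in> T ` ?N'}"
        by blast
    next
      fix y
      assume "y \<in> {y. \<exists>k. y - k *\<^sub>C T v \<in> T ` ?N'}"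
      then obtain k x where x: "x \<in> ?N'" "y - k *\<^sub>C T v = T x"
        by blast
      then have "y = T (x + k *\<^sub>C v)"
        by (simp add: bounded_clinear_add[OF T] bounded_clinear_scaleC[OF T] algebra_simps)
      moreover have "x + k *\<^sub>C v \<in> ?N"
        using x(1) v(1) by (simp add: cinner_simps)
      ultimately show "y \<in> T ` ?N"
        by blast
    qed
    then have "closed (T ` ?N)"
      using closed_subspace_plus_line[OF sub insert.prems] by simp
    then show ?thesis
      by (rule insert.IH)
  qed
qed

text \<open>A lower bound on the complement of \<open>G\<close> lets the kernel meet it only in 0
  and makes its image complete. Conversely, let \<open>G\<close> span the kernel. Since
  \<open>cadjoint T\<close> is bounded below on the closed space \<open>range T\<close>, the
  operator \<open>T \<circ> cadjoint T\<close> is coercive there. Solving with it shows that every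
  \<open>x\<close> orthogonal to the kernel is \<open>cadjoint T g\<close> for some \<open>g\<close>
  in \<open>range T\<close>, and duality then bounds \<open>norm x\<close> by
  \<open>norm (T x)\<close>.\<close>

lemma upper_semi_Fredholm_iff:
  assumes T: "bounded_clinear (T :: 'a :: chilbert_space \<Rightarrow> 'a)"
  shows "upper_semi_Fredholm T \<longleftrightarrow> cofinitely_bounded_below T"
proof
  assume "cofinitely_bounded_below T"
  then obtain G c where G: "finite G" "c > 0"
    and lower: "\<And>x. x \<in> orthogonal_space G \<Longrightarrow> c * norm x \<le> norm (T x)"
    by (auto simp: cofinitely_bounded_below_def)
  have "finite_cdim {x. T x = 0}"
  proof (rule ccontr)
    assume "\<not> ?thesis"
    then obtain x where x0: "x \<in> {x. T x = 0}" "x \<noteq> 0" "\<And>g. g \<in> G \<Longrightarrow> cinner x g = 0"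
      by (rule exists_orthogonal_vector[OF subspace_kernel[OF T] _ G(1)]) blast
    then have x: "T x = 0" "x \<noteq> 0" "x \<in> orthogonal_space G"
      by auto
    have "c * norm x > 0"
      using G(2) x(2) by simp
    then show False
      using lower[OF x(3)] x(1) by simp
  qed
  moreover have "closed (range T)"
  proof (rule closed_range_of_closed_orthogonal_image[OF T G(1)])
    have "complete (T ` orthogonal_space G)"
      using G(2) lower
      by (intro complete_isometric_image[of c] bounded_clinear_bounded_linear T
          subspace_imp_real_subspace subspace_orthogonal_space)
        (simp_all add: complete_eq_closed closed_orthogonal_space)
    then show "closed (T ` orthogonal_space G)"
      by (simp add: complete_eq_closed)
  qed
  ultimately show "upper_semi_Fredholm T"
    using T by (simp add: upper_semi_Fredholm_def)
next
  assume "upper_semi_Fredholm T"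
  then obtain G where closed: "closed (range T)" and G: "finite G" "complex_vector.span G = {x. T x = 0}"
    by (auto simp: upper_semi_Fredholm_def finite_cdim_def)
  have T': "bounded_clinear (cadjoint T)"
    by (rule bounded_clinear_cadjoint[OF T])
  obtain c where c: "c > 0" "\<And>f. f \<in> range T \<Longrightarrow> c * norm f \<le> norm (cadjoint T f)"
    using cadjoint_bounded_below[OF T subspace_range[OF T] closed] by blast
  have "c * norm x \<le> norm (T x)" if x: "x \<in> orthogonal_space G" for x
  proof -
    have coercive: "c\<^sup>2 * (norm y)\<^sup>2 \<le> Re (cinner (T (cadjoint T y)) y)" if "y \<in> range T" for y
    proof -
      have "(c * norm y)\<^sup>2 \<le> (norm (cadjoint T y))\<^sup>2"
        using c(1) by (intro power_mono c(2) that) auto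
      then show ?thesis
        by (simp add: cadjoint[OF T] cinner_self power_mult_distrib del: of_real_power)
    qed
    obtain g where g: "g \<in> range T" "T (cadjoint T g) = T x"
      using lax_milgram[OF bounded_clinear_compose[OF T T'] subspace_range[OF T] closed _ _ coercive, of "T x"]
        c(1) by auto
    \<comment> \<open>The difference lies in the kernel, so it is orthogonal to \<open>x\<close> by
      the choice of \<open>G\<close> and to \<open>cadjoint T g\<close> by adjointness, hence to
      itself.\<close>
    define z where "z = x - cadjoint T g"
    have "T z = 0"
      using g(2) by (simp add: z_def bounded_clinear_diff[OF T])
    then have "cinner z x = 0" "cinner z (cadjoint T g) = 0"
      using cinner_span_eq_zero(2)[OF x] G(2) cadjoint[OF T, of z g] by auto
    then have "cinner z z = 0"
      by (simp add: z_def cinner_diff_right)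
    then have xg: "x = cadjoint T g"
      by (simp add: cinner_self_zero z_def)
    have "(norm x)\<^sup>2 = norm (cinner x (cadjoint T g))"
      using xg by (simp add: cinner_self norm_power)
    also have "\<dots> \<le> norm (T x) * norm g"
      using cauchy_schwarz by (simp add: cadjoint[OF T, symmetric])
    finally have "c * (norm x)\<^sup>2 \<le> norm (T x) * (c * norm g)"
      using c(1) by (simp add: mult.left_commute)
    also have "\<dots> \<le> norm (T x) * norm x"
      using c(2)[OF g(1)] xg by (intro mult_left_mono) auto
    finally show ?thesis
      by (cases "x = 0") (auto simp: power2_eq_square)
  qed
  then show "cofinitely_bounded_below T"
    using G(1) c(1) by (auto simp: cofinitely_bounded_below_def)
qed

section \<open>Finite orthonormal sets\<close>

definition corthonormal :: "'a :: chilbert_space set \<Rightarrow> bool" where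
  "corthonormal G \<longleftrightarrow> (\<forall>g\<in>G. \<forall>h\<in>G. cinner g h = (if g = h then 1 else 0))"

lemma cinner_orthonormal_sum:
  assumes "finite G" "corthonormal G" "h \<in> G"
  shows "cinner (\<Sum>g\<in>G. c g *\<^sub>C g) h = c h"
proof -
  have "cinner (\<Sum>g\<in>G. c g *\<^sub>C g) h = (\<Sum>g\<in>G. if g = h then c g else 0)"
    unfolding cinner_sum_left cinner_scaleC_left
    using assms by (intro sum.cong) (auto simp: corthonormal_def)
  then show ?thesis
    using assms by simp
qed

lemma gram_schmidt_step:
  assumes "finite G" "corthonormal G" "h \<in> G"
  shows "cinner (x - (\<Sum>g\<in>G. cinner x g *\<^sub>C g)) h = 0"
  using cinner_orthonormal_sum[OF assms] by (simp add: cinner_simps)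

text \<open>Allows the orthogonal projection onto the span of the exceptional vectors to be written
  as an explicit finite sum.\<close>

lemma exists_orthonormal_finite:
  assumes "finite (G :: 'a :: chilbert_space set)"
  obtains G' where "finite G'" "corthonormal G'" "orthogonal_space G' = orthogonal_space G"
  using assms
proof (induction arbitrary: thesis)
  case empty
  show ?case
    by (rule empty[of "{}"]) (auto simp: corthonormal_def)
next
  case (insert g G)
  obtain H where H: "finite H" "corthonormal H" "orthogonal_space H = orthogonal_space G"
    using insert.IH by blast
  define s where "s = (\<Sum>h\<in>H. cinner g h *\<^sub>C h)"
  define p where "p = g - s"
  have p: "cinner p h = 0" if "h \<in> H" for h
    using gram_schmidt_step[OF H(1,2) that, of g] by (simp add: p_def s_def)
  have "s \<in> complex_vector.span H"
    unfolding s_def by (intro complex_vector.span_sum complex_vector.span_scale complex_vector.span_base)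
  then have s: "cinner x s = 0" if "x \<in> orthogonal_space H" for x
    using cinner_span_eq_zero(1) that by blast
  have "orthogonal_space (insert g G) = {x \<in> orthogonal_space G. cinner x g = 0}"
    by auto
  also have "\<dots> = {x \<in> orthogonal_space H. cinner x p = 0}"
    using s H(3) by (auto simp: p_def cinner_simps)
  finally have *: "orthogonal_space (insert g G) = {x \<in> orthogonal_space H. cinner x p = 0}" .
  show ?case
  proof (cases "p = 0")
    case True
    then show ?thesis
      using H * by (intro insert.prems[of H]) auto
  next
    case False
    define u where "u = of_real (1 / norm p) *\<^sub>C p"
    have u: "norm u = 1" 
      using False by (simp add: u_def norm_scaleC norm_divide)
    have uH: "cinner u h = 0" if "h \<in> H" for h
      using p[OF that] by (simp add: u_def cinner_simps)
    have "u \<notin> H"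
      using u uH[of u] by (auto simp: cinner_self)
    then have "corthonormal (insert u H)"
      using H(2) u uH by (auto simp: corthonormal_def cinner_self cinner_eq_zero_swap[of _ u])
    moreover have "orthogonal_space (insert u H) = orthogonal_space (insert g G)"
      unfolding * using False by (auto simp: u_def cinner_simps)
    ultimately show ?thesis
      using H(1) by (intro insert.prems[of "insert u H"]) auto
  qed
qed

text \<open>If the cosets of \<open>G\<close> span the quotient by the range, each \<open>y\<close>
  pairs with the complement of \<open>G\<close> as some \<open>T x\<close> does, and
  \<open>cadjoint_bounded_below\<close> applies. Conversely, with \<open>P\<close> the projection to
  the span of \<open>G\<close>, the operator \<open>T \<circ> cadjoint T + P\<close> is coercive on
  the whole space. So every \<open>y\<close> is \<open>T (cadjoint T x) + P x\<close>, that is, a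
  vector of the range up to one of the span.\<close>

lemma lower_semi_Fredholm_iff:
  assumes T: "bounded_clinear (T :: 'a :: chilbert_space \<Rightarrow> 'a)"
  shows "lower_semi_Fredholm T \<longleftrightarrow> cofinitely_bounded_below (cadjoint T)"
proof
  assume "lower_semi_Fredholm T"
  then obtain G where G: "finite G" "\<And>x. \<exists>b\<in>complex_vector.span G. x - b \<in> range T"
    by (auto simp: lower_semi_Fredholm_def finite_ccodim_def)
  have "\<exists>x. \<forall>f\<in>orthogonal_space G. cinner y f = cinner (T x) f" for y
  proof -
    obtain b x where b: "b \<in> complex_vector.span G" and x: "y - b = T x"
      using G(2)[of y] by auto
    have "cinner y f = cinner (T x) f" if "f \<in> orthogonal_space G" for f
      using cinner_span_eq_zero(2)[OF that b] by (simp add: cinner_diff_left flip: x)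
    then show ?thesis
      by blast
  qed
  then obtain c where "c > 0" "\<And>f. f \<in> orthogonal_space G \<Longrightarrow> c * norm f \<le> norm (cadjoint T f)"
    by (rule cadjoint_bounded_below[OF T subspace_orthogonal_space closed_orthogonal_space]) blast
  then show "cofinitely_bounded_below (cadjoint T)"
    using G(1) by (auto simp: cofinitely_bounded_below_def)
next
  assume "cofinitely_bounded_below (cadjoint T)"
  then obtain G0 c where G0: "finite G0" and c: "c > 0"
    and "\<And>x. x \<in> orthogonal_space G0 \<Longrightarrow> c * norm x \<le> norm (cadjoint T x)"
    by (auto simp: cofinitely_bounded_below_def)
  moreover obtain G where G: "finite G" "corthonormal G" "orthogonal_space G = orthogonal_space G0"
    using exists_orthonormal_finite[OF G0] .
  ultimately have lower: "c * norm x \<le> norm (cadjoint T x)" if "x \<in> orthogonal_space G" for x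
    using that by blast
  have T': "bounded_clinear (cadjoint T)"
    by (rule bounded_clinear_cadjoint[OF T])
  obtain B where B: "B > 0" "\<And>x. norm (cadjoint T x) \<le> B * norm x"
    using T' bounded_clinear_bound by metis
  define P where "P x = (\<Sum>g\<in>G. cinner x g *\<^sub>C g)" for x
  have P_perp: "x - P x \<in> orthogonal_space G" for x
    using gram_schmidt_step[OF G(1,2)] by (auto simp: P_def)
  have P_span: "P x \<in> complex_vector.span G" for x
    unfolding P_def by (intro complex_vector.span_sum complex_vector.span_scale complex_vector.span_base)
  have P_self: "cinner (P x) x = of_real ((norm (P x))\<^sup>2)" for x
  proof -
    have "cinner (P x) (x - P x) = 0"
      by (rule cinner_span_eq_zero(2)[OF P_perp P_span])
    then show ?thesis
      by (simp add: cinner_simps cinner_self)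
  qed
  have "bounded_clinear P"
  proof (rule bounded_clinearI)
    show "P (x + y) = P x + P y" for x y
      by (simp add: P_def cinner_simps scaleC_add_left sum.distrib)
    show "P (k *\<^sub>C x) = k *\<^sub>C P x" for k x
      by (simp add: P_def cinner_simps scaleC_scaleC complex_vector.scale_sum_right)
    show "norm (P x) \<le> (\<Sum>g\<in>G. norm g * norm g) * norm x" for x
    proof -
      have "norm (P x) \<le> (\<Sum>g\<in>G. norm (cinner x g *\<^sub>C g))"
        unfolding P_def by (rule norm_sum)
      also have "\<dots> \<le> (\<Sum>g\<in>G. (norm x * norm g) * norm g)"
        unfolding norm_scaleC by (intro sum_mono mult_right_mono cauchy_schwarz) auto
      finally show ?thesis
        by (simp add: sum_distrib_left mult_ac)
    qed
  qed
  \<comment> \<open>Splitting \<open>x\<close> into \<open>x - P x\<close> and \<open>P x\<close>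
    yields the coefficients \<open>1 / c\<close> at \<open>norm (cadjoint T x)\<close> and
    \<open>B / c + 1\<close> at \<open>norm (P x)\<close>; \<open>K\<close> exceeds both.\<close>
  define K where "K = (1 + B) / c + 1"
  have K: "K > 0" "norm x \<le> K * (norm (cadjoint T x) + norm (P x))" for x
  proof -
    show "K > 0"
      using c B(1) by (simp add: K_def add_pos_pos)
    have "c * norm (x - P x) \<le> norm (cadjoint T x - cadjoint T (P x))"
      using lower[OF P_perp] by (simp add: bounded_clinear_diff[OF T'])
    also have "\<dots> \<le> norm (cadjoint T x) + B * norm (P x)"
      using norm_triangle_ineq4[of "cadjoint T x" "cadjoint T (P x)"] B(2)[of "P x"] by simp
    finally have "norm (x - P x) \<le> (norm (cadjoint T x) + B * norm (P x)) / c"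
      using c by (simp add: field_simps)
    then have "norm x \<le> (norm (cadjoint T x) + B * norm (P x)) / c + norm (P x)"
      using norm_triangle_ineq[of "x - P x" "P x"] by simp
    also have "\<dots> \<le> K * (norm (cadjoint T x) + norm (P x))"
      using c B(1) by (simp add: K_def field_simps)
    finally show "norm x \<le> K * (norm (cadjoint T x) + norm (P x))" .
  qed
  have A: "bounded_clinear (\<lambda>x. T (cadjoint T x) + P x)"
    by (rule bounded_clinear_plus[OF bounded_clinear_compose[OF T T'] \<open>bounded_clinear P\<close>])
  \<comment> \<open>The 2 comes from
    \<open>(a + b)\<^sup>2 \<le> 2 * (a\<^sup>2 + b\<^sup>2)\<close>.\<close>
  have coercive: "1 / (2 * K\<^sup>2) * (norm x)\<^sup>2 \<le> Re (cinner (T (cadjoint T x) + P x) x)" for x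
  proof -
    let ?a = "norm (cadjoint T x)" and ?b = "norm (P x)"
    have "(norm x)\<^sup>2 \<le> (K * (?a + ?b))\<^sup>2"
      by (intro power_mono K) auto
    also have "\<dots> \<le> K\<^sup>2 * (2 * (?a\<^sup>2 + ?b\<^sup>2))"
      unfolding power_mult_distrib using zero_le_power2[of "?a - ?b"]
      by (intro mult_left_mono) (auto simp: power2_eq_square algebra_simps)
    also have "?a\<^sup>2 + ?b\<^sup>2 = Re (cinner (T (cadjoint T x) + P x) x)"
      by (simp add: cinner_add_left cadjoint[OF T] P_self cinner_self del: of_real_power)
    finally show ?thesis
      using K(1) by (simp add: field_simps)
  qed
  have "\<exists>b\<in>complex_vector.span G. y - b \<in> range T" for y
  proof -
    obtain x where "T (cadjoint T x) + P x = y"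
      using lax_milgram[OF A complex_vector.subspace_UNIV closed_UNIV _ _ coercive, of y] K(1) by auto
    then have "y - P x = T (cadjoint T x)"
      by auto
    then show ?thesis
      using P_span by (intro bexI[of _ "P x"]) auto
  qed
  then show "lower_semi_Fredholm T"
    using T G(1) by (auto simp: lower_semi_Fredholm_def finite_ccodim_def)
qed

section \<open>Factorization along a staircase basis\<close>

text \<open>Read \<open>E t x\<close> as "a weighted norm of \<open>x\<close> is at most
  \<open>t\<close>". It is a predicate because this norm may be infinite. \<open>A\<close> contracts
  it by \<open>e\<close>, \<open>A ^^ k\<close> makes it finite, and one more \<open>A\<close> leads
  back to the original norm, so \<open>norm ((A ^^ (n + k + 1)) x)\<close> is at most
  \<open>C * D * e ^ n * norm x\<close>. Weights and constants may depend on
  \<open>e\<close>.\<close>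

lemma power_decayI:
  fixes A :: "'a :: chilbert_space \<Rightarrow> 'a"
  assumes A: "bounded_clinear A"
    and "\<And>e :: real. 0 < e \<Longrightarrow> e < 1 \<Longrightarrow> \<exists>E k D C. (\<forall>t x. E t x \<longrightarrow> E (e * t) (A x)) \<and>
      (\<forall>x. E (D * norm x) ((A ^^ k) x)) \<and> (\<forall>t x. E t x \<longrightarrow> norm (A x) \<le> C * t)"
  shows "power_decay A"
proof -
  obtain B0 where B0: "\<And>x. norm (A x) \<le> B0 * norm x"
    using A bounded_clinear_bound by metis
  define B where "B = max 1 B0"
  have B: "B \<ge> 1" "norm (A x) \<le> B * norm x" for x
    using B0[of x] mult_right_mono[of B0 B "norm x"] by (auto simp: B_def)
  have small: "\<exists>D. \<forall>n x. norm ((A ^^ n) x) \<le> D * e ^ n * norm x" if e: "0 < e" "e < 1" for e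
  proof -
    obtain E k D C where step: "\<And>t x. E t x \<Longrightarrow> E (e * t) (A x)"
      and init: "\<And>x. E (D * norm x) ((A ^^ k) x)" and final: "\<And>t x. E t x \<Longrightarrow> norm (A x) \<le> C * t"
      using assms(2)[OF e] by metis
    \<comment> \<open>The division compensates the index shift by \<open>Suc k\<close>; the summand
      \<open>B ^ Suc k\<close> takes care of the powers up to \<open>k\<close>.\<close>
    define M where "M = (\<bar>C * D\<bar> + B ^ Suc k) / e ^ Suc k"
    have E: "E (e ^ n * (D * norm x)) ((A ^^ (n + k)) x)" for n x
    proof (induction n)
      case (Suc n)
      show ?case
        using step[OF Suc] by (simp add: mult.assoc)
    qed (use init in simp)
    have "norm ((A ^^ n) x) \<le> M * e ^ n * norm x" for n x
    proof (cases "n \<le> k")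
      case True
      have "norm ((A ^^ n) x) \<le> B ^ n * norm x"
        using B by (intro norm_funpow_le) auto
      also have "B ^ n \<le> B ^ Suc k"
        using True B(1) by (intro power_increasing) auto
      also have "B ^ Suc k \<le> B ^ Suc k * (e ^ n / e ^ Suc k)"
        using True e B(1) power_decreasing[of n "Suc k" e]
        by (simp add: le_divide_eq del: power_Suc)
      also have "\<dots> \<le> M * e ^ n"
        using e by (simp add: M_def divide_right_mono del: power_Suc flip: times_divide_eq_right)
      finally show ?thesis
        by (simp add: mult_right_mono)
    next
      case False
      define j where "j = n - Suc k"
      have n: "n = Suc (j + k)"
        using False by (simp add: j_def)
      have "norm ((A ^^ n) x) \<le> C * (e ^ j * (D * norm x))"
        using final[OF E[of j x]] by (simp add: n)
      also have "\<dots> \<le> \<bar>C * D\<bar> * (e ^ j * norm x)"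
        using e mult_right_mono[OF abs_ge_self[of "C * D"], of "e ^ j * norm x"] by (simp add: mult_ac)
      also have "\<dots> \<le> (\<bar>C * D\<bar> + B ^ Suc k) * (e ^ j * norm x)"
        using e B(1) by (intro mult_right_mono) auto
      also have "\<dots> = M * e ^ n * norm x"
        using e by (simp add: M_def n power_add)
      finally show ?thesis .
    qed
    then show ?thesis
      by blast
  qed
  show ?thesis
    unfolding power_decay_def
  proof (intro allI impI)
    fix e :: real
    assume e: "e > 0"
    define e' where "e' = min e (1 / 2)"
    have "0 < e'" "e' < 1"
      using e by (auto simp: e'_def min_def)
    then obtain D where D: "\<And>n x. norm ((A ^^ n) x) \<le> D * e' ^ n * norm x"
      using small by metis
    have "norm ((A ^^ n) x) \<le> \<bar>D\<bar> * e ^ n * norm x" for n x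
    proof -
      have "D * e' ^ n \<le> \<bar>D\<bar> * e ^ n"
        using e by (intro mult_mono power_mono) (auto simp: e'_def)
      then show ?thesis
        by (intro order_trans[OF D mult_right_mono]) auto
    qed
    then show "\<exists>D. \<forall>n x. norm ((A ^^ n) x) \<le> D * e ^ n * norm x"
      by blast
  qed
qed

section \<open>Bessel sequences and operators given on orthogonal sequences\<close>

definition orthogonal_seq :: "(nat \<Rightarrow> 'a :: chilbert_space) \<Rightarrow> bool" where
  "orthogonal_seq b \<longleftrightarrow> (\<forall>n. norm (b n) \<le> 1) \<and> (\<forall>m n. m \<noteq> n \<longrightarrow> cinner (b m) (b n) = 0)"

text \<open>\<open>C\<close> bounds the map from square-summable coefficients to linear combinations
  of the \<open>w n\<close>; then \<open>C\<^sup>2\<close> is a Bessel constant.\<close>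

definition bessel_bound :: "real \<Rightarrow> (nat \<Rightarrow> 'a :: chilbert_space) \<Rightarrow> bool" where
  "bessel_bound C w \<longleftrightarrow> C \<ge> 0 \<and>
     (\<forall>F c. finite F \<longrightarrow> norm (\<Sum>n\<in>F. c n *\<^sub>C w n) \<le> C * L2_set (\<lambda>n. norm (c n)) F)"

lemma bessel_bound_orthogonal_seq:
  assumes "orthogonal_seq w"
  shows "bessel_bound 1 w"
proof -
  have "(norm (\<Sum>n\<in>F. c n *\<^sub>C w n))\<^sup>2 \<le> (\<Sum>n\<in>F. (norm (c n))\<^sup>2)" if "finite F" for F c
    using that
  proof induction
    case (insert k F)
    have "cinner (c k *\<^sub>C w k) (\<Sum>n\<in>F. c n *\<^sub>C w n) = cnj (\<Sum>n\<in>F. c n * (cnj (c k) * cinner (w n) (w k)))"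
      by (subst cinner_commute) (simp add: cinner_sum_left cinner_simps sum_distrib_left mult_ac)
    also have "(\<Sum>n\<in>F. c n * (cnj (c k) * cinner (w n) (w k))) = 0"
    proof (intro sum.neutral ballI)
      fix n
      assume "n \<in> F"
      then have "cinner (w n) (w k) = 0"
        using assms insert(2) unfolding orthogonal_seq_def by metis
      then show "c n * (cnj (c k) * cinner (w n) (w k)) = 0"
        by simp
    qed
    finally have "(norm (\<Sum>n\<in>insert k F. c n *\<^sub>C w n))\<^sup>2
        = (norm (c k *\<^sub>C w k))\<^sup>2 + (norm (\<Sum>n\<in>F. c n *\<^sub>C w n))\<^sup>2"
      using insert(1,2) by (simp add: norm_add_sq)
    moreover have "(norm (c k *\<^sub>C w k))\<^sup>2 \<le> (norm (c k))\<^sup>2"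
      using assms by (intro power_mono) (auto simp: norm_scaleC orthogonal_seq_def mult_left_le)
    ultimately have "(norm (\<Sum>n\<in>insert k F. c n *\<^sub>C w n))\<^sup>2
        \<le> (norm (c k))\<^sup>2 + (\<Sum>n\<in>F. (norm (c n))\<^sup>2)"
      using insert.IH by linarith
    then show ?case
      using insert(1,2) by simp
  qed simp
  then show ?thesis
    by (auto simp: bessel_bound_def L2_set_def intro: real_le_rsqrt)
qed

lemma bessel_bound_image:
  assumes T: "bounded_clinear T" "\<And>x. norm (T x) \<le> B * norm x" "B \<ge> 0" and w: "orthogonal_seq w"
  shows "bessel_bound B (\<lambda>n. T (w n))"
  unfolding bessel_bound_def
proof (intro conjI allI impI)
  fix F :: "nat set" and c :: "nat \<Rightarrow> complex"
  assume "finite F"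
  then have "norm (\<Sum>n\<in>F. c n *\<^sub>C w n) \<le> L2_set (\<lambda>n. norm (c n)) F"
    using bessel_bound_orthogonal_seq[OF w] by (simp add: bessel_bound_def)
  moreover have "(\<Sum>n\<in>F. c n *\<^sub>C T (w n)) = T (\<Sum>n\<in>F. c n *\<^sub>C w n)"
    by (simp add: bounded_clinear_sum[OF T(1)] bounded_clinear_scaleC[OF T(1)])
  ultimately show "norm (\<Sum>n\<in>F. c n *\<^sub>C T (w n)) \<le> B * L2_set (\<lambda>n. norm (c n)) F"
    using order_trans[OF T(2) mult_left_mono] T(3) by metis
qed (rule T(3))

lemma bessel_bound_summable:
  assumes "summable d" "\<And>n. norm (w n) \<le> d n"
  shows "bessel_bound (\<Sum>n. d n) w"
  unfolding bessel_bound_def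
proof (intro conjI allI impI)
  have d: "d n \<ge> 0" for n
    using assms(2)[of n] norm_ge_zero order_trans by blast
  then show "0 \<le> (\<Sum>n. d n)"
    by (rule suminf_nonneg[OF assms(1)])
  fix F :: "nat set" and c :: "nat \<Rightarrow> complex"
  assume F: "finite F"
  let ?L = "L2_set (\<lambda>n. norm (c n)) F"
  have "norm (\<Sum>n\<in>F. c n *\<^sub>C w n) \<le> (\<Sum>n\<in>F. norm (c n) * norm (w n))"
    using norm_sum[of "\<lambda>n. c n *\<^sub>C w n" F] by (simp add: norm_scaleC)
  also have "\<dots> \<le> (\<Sum>n\<in>F. ?L * d n)"
    using F by (intro sum_mono mult_mono assms member_le_L2_set) auto
  also have "\<dots> = ?L * (\<Sum>n\<in>F. d n)"
    by (simp add: sum_distrib_left)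
  also have "\<dots> \<le> ?L * (\<Sum>n. d n)"
    using F d by (intro mult_left_mono sum_le_suminf assms) auto
  finally show "norm (\<Sum>n\<in>F. c n *\<^sub>C w n) \<le> (\<Sum>n. d n) * ?L"
    by (simp add: mult.commute)
qed

text \<open>The vectors need not be normalized, so \<open>?s\<close> need not be a projection of
  \<open>x\<close>. It suffices that \<open>cinner ?s x = ?L\<^sup>2\<close> and
  \<open>norm ?s \<le> ?L\<close>.\<close>

lemma bessel_inequality:
  assumes b: "orthogonal_seq b" and F: "finite F"
  shows "L2_set (\<lambda>n. norm (cinner x (b n))) F \<le> norm x"
proof -
  let ?s = "\<Sum>n\<in>F. cinner x (b n) *\<^sub>C b n" and ?L = "L2_set (\<lambda>n. norm (cinner x (b n))) F"
  have L: "norm ?s \<le> ?L"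
    using bessel_bound_orthogonal_seq[OF b] F by (simp add: bessel_bound_def)
  have "cinner ?s x = of_real (?L\<^sup>2)"
  proof -
    have "cinner ?s x = (\<Sum>n\<in>F. of_real ((norm (cinner x (b n)))\<^sup>2))"
      unfolding cinner_sum_left cinner_scaleC_left
      by (intro sum.cong refl) (metis cinner_commute complex_norm_square of_real_power)
    then show ?thesis
      by (simp add: L2_set_def sum_nonneg)
  qed
  then have "?L\<^sup>2 = norm (cinner ?s x)"
    by (simp add: norm_power)
  also have "\<dots> \<le> ?L * norm x"
    using order_trans[OF cauchy_schwarz mult_right_mono[OF L]] by simp
  finally show ?thesis
    using L2_set_nonneg[of "\<lambda>n. norm (cinner x (b n))" F]
    by (cases "?L = 0") (auto simp: power2_eq_square mult_le_cancel_left)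
qed

text \<open>For orthonormal \<open>b\<close>, the operator that maps \<open>b n\<close> to
  \<open>w n\<close> and kills the orthogonal complement of the \<open>b n\<close>.\<close>

definition synthesis :: "(nat \<Rightarrow> 'a) \<Rightarrow> (nat \<Rightarrow> 'a) \<Rightarrow> 'a \<Rightarrow> 'a :: chilbert_space" where
  "synthesis b w x = (\<Sum>n. cinner x (b n) *\<^sub>C w n)"

lemma summable_synthesis:
  assumes b: "orthogonal_seq b" and w: "bessel_bound C w"
  shows "summable (\<lambda>n. cinner x (b n) *\<^sub>C w n)"
  unfolding summable_Cauchy
proof (intro allI impI)
  fix e :: real
  assume e: "e > 0"
  have C: "C \<ge> 0"
    using w by (simp add: bessel_bound_def)
  let ?c = "\<lambda>n. (norm (cinner x (b n)))\<^sup>2"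
  have "summable ?c"
  proof (rule summableI_nonneg_bounded)
    show "sum ?c {..<n} \<le> (norm x)\<^sup>2" for n
      using power_mono[OF bessel_inequality[OF b, of "{..<n}" x] L2_set_nonneg, of 2]
      by (simp add: L2_set_def sum_nonneg)
  qed auto
  then obtain N where N: "\<And>m n. m \<ge> N \<Longrightarrow> norm (sum ?c {m..<n}) < (e / (C + 1))\<^sup>2"
    unfolding summable_Cauchy using e C by (meson zero_less_power divide_pos_pos add_nonneg_pos zero_less_one)
  have "norm (\<Sum>n\<in>{m..<n}. cinner x (b n) *\<^sub>C w n) < e" if "m \<ge> N" for m n
  proof -
    let ?L = "L2_set (\<lambda>n. norm (cinner x (b n))) {m..<n}"
    have "?L < e / (C + 1)"
    proof (rule power2_less_imp_less)
      show "?L\<^sup>2 < (e / (C + 1))\<^sup>2"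
        using N[OF that, of n] by (simp add: L2_set_def sum_nonneg)
    qed (use e C in simp)
    have "norm (\<Sum>n\<in>{m..<n}. cinner x (b n) *\<^sub>C w n) \<le> C * ?L"
      using w by (simp add: bessel_bound_def)
    also have "\<dots> \<le> (C + 1) * ?L"
      by (intro mult_right_mono L2_set_nonneg) auto
    also have "\<dots> < e"
      using \<open>?L < e / (C + 1)\<close> C by (simp add: field_simps)
    finally show ?thesis .
  qed
  then show "\<exists>N. \<forall>m\<ge>N. \<forall>n. norm (\<Sum>n\<in>{m..<n}. cinner x (b n) *\<^sub>C w n) < e"
    by blast
qed

lemma norm_synthesis_le:
  assumes b: "orthogonal_seq b" and w: "bessel_bound C w"
  shows "norm (synthesis b w x) \<le> C * norm x"
proof (rule LIMSEQ_le_const2)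
  show "(\<lambda>N. norm (\<Sum>n<N. cinner x (b n) *\<^sub>C w n)) \<longlonglongrightarrow> norm (synthesis b w x)"
    unfolding synthesis_def by (intro tendsto_norm summable_LIMSEQ summable_synthesis[OF assms])
  have "norm (\<Sum>n<N. cinner x (b n) *\<^sub>C w n) \<le> C * norm x" for N
  proof -
    have "norm (\<Sum>n<N. cinner x (b n) *\<^sub>C w n) \<le> C * L2_set (\<lambda>n. norm (cinner x (b n))) {..<N}"
      using w by (simp add: bessel_bound_def)
    also have "\<dots> \<le> C * norm x"
      using w bessel_inequality[OF b] by (intro mult_left_mono) (auto simp: bessel_bound_def)
    finally show ?thesis .
  qed
  then show "\<exists>N. \<forall>n\<ge>N. norm (\<Sum>n<n. cinner x (b n) *\<^sub>C w n) \<le> C * norm x"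
    by blast
qed

lemma bounded_clinear_synthesis:
  assumes b: "orthogonal_seq b" and w: "bessel_bound C w"
  shows "bounded_clinear (synthesis b w)"
proof (rule bounded_clinearI[OF _ _ norm_synthesis_le[OF assms]])
  show "synthesis b w (x + y) = synthesis b w x + synthesis b w y" for x y
    unfolding synthesis_def cinner_add_left scaleC_add_left
    by (rule suminf_add[symmetric]) (intro summable_synthesis[OF assms])+
  show "synthesis b w (k *\<^sub>C x) = k *\<^sub>C synthesis b w x" for k x
    unfolding synthesis_def cinner_scaleC_left
    using bounded_linear.suminf[OF bounded_bilinear.bounded_linear_right[OF bounded_bilinear_scaleC]
        summable_synthesis[OF assms], of k x]
    by (simp add: scaleC_scaleC)
qed

lemma synthesis_image:
  assumes b: "orthogonal_seq b" and w: "orthogonal_seq w" and T: "bounded_clinear T"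
  shows "synthesis b (\<lambda>n. T (w n)) x = T (synthesis b w x)"
  unfolding synthesis_def
  using bounded_linear.suminf[OF bounded_clinear_bounded_linear[OF T]
      summable_synthesis[OF b bessel_bound_orthogonal_seq[OF w]]]
  by (simp add: bounded_clinear_scaleC[OF T])

lemma synthesis_eq_zero:
  assumes "\<And>n. cinner x (b n) = 0"
  shows "synthesis b w x = 0"
  by (simp add: synthesis_def assms)

lemma synthesis_basis:
  assumes "orthogonal_seq b"
  shows "synthesis b w (b k) = cinner (b k) (b k) *\<^sub>C w k"
proof -
  have "synthesis b w (b k) = (\<Sum>n\<in>{k}. cinner (b k) (b n) *\<^sub>C w n)"
    unfolding synthesis_def using assms
    by (intro suminf_finite) (auto simp: orthogonal_seq_def)
  then show ?thesis
    by simp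
qed

lemma cinner_synthesis_sums:
  assumes b: "orthogonal_seq b" and w: "bessel_bound C w"
  shows "(\<lambda>n. cinner x (b n) * cinner (w n) y) sums cinner (synthesis b w x) y"
  using bounded_linear.sums[OF bounded_linear_cinner_left summable_sums[OF summable_synthesis[OF b w]]]
  by (simp add: cinner_scaleC_left synthesis_def)

lemma cinner_synthesis_single:
  assumes b: "orthogonal_seq b" and w: "bessel_bound C w" and "\<And>n. n \<noteq> k \<Longrightarrow> cinner (w n) y = 0"
  shows "cinner (synthesis b w x) y = cinner x (b k) * cinner (w k) y"
proof -
  have "(\<lambda>n. cinner x (b n) * cinner (w n) y) sums (\<Sum>n\<in>{k}. cinner x (b n) * cinner (w n) y)"
    using assms(3) by (intro sums_finite) auto
  then show ?thesis
    using sums_unique2[OF cinner_synthesis_sums[OF b w]] by simp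
qed

lemma cinner_synthesis_zero:
  assumes b: "orthogonal_seq b" and w: "bessel_bound C w" and "\<And>n. cinner (w n) y = 0"
  shows "cinner (synthesis b w x) y = 0"
  using cinner_synthesis_single[OF assms(1,2), of 0 y x] assms(3) by simp

lemma norm_synthesis_le_suminf:
  assumes "summable d" "\<And>n. norm (cinner x (b n)) * norm (w n) \<le> d n"
  shows "norm (synthesis b w x) \<le> (\<Sum>n. d n)"
proof -
  have *: "summable (\<lambda>n. norm (cinner x (b n) *\<^sub>C w n))"
    by (rule summable_comparison_test'[OF assms(1)]) (simp add: norm_scaleC assms(2))
  have "norm (synthesis b w x) \<le> (\<Sum>n. norm (cinner x (b n) *\<^sub>C w n))"
    unfolding synthesis_def by (rule summable_norm[OF *])
  also have "\<dots> \<le> (\<Sum>n. d n)"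
    by (intro suminf_le * assms(1)) (simp add: norm_scaleC assms(2))
  finally show ?thesis .
qed

text \<open>Estimates a row of a strictly triangular matrix: the first possible term has index
  \<open>i + 1\<close> and size \<open>s ^ (2 * i + 2)\<close>, and the rest is geometric with ratio
  at most 1/2.\<close>

lemma norm_sums_tail_le:
  fixes f :: "nat \<Rightarrow> complex"
  assumes S: "f sums S" and zero: "\<And>p. p \<le> i \<Longrightarrow> f p = 0"
    and le: "\<And>p. norm (f p) \<le> M * s ^ (2 * p)" and s: "0 \<le> s" "s \<le> 1 / 2"
  shows "norm S \<le> 2 * M * s ^ (2 * i + 2)"
proof -
  have M: "M \<ge> 0"
    using le[of 0] norm_ge_zero[of "f 0"] by (simp del: norm_ge_zero) 
  have "(\<lambda>p. f (p + Suc i)) sums S"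
    using sums_split_initial_segment[OF S, of "Suc i"] zero by simp
  moreover have "(\<lambda>p. M * s ^ (2 * i + 2) * (1 / 2) ^ p) sums (M * s ^ (2 * i + 2) * 2)"
    using sums_mult[OF geometric_sums[of "1 / 2 :: real"], of "M * s ^ (2 * i + 2)"] by simp
  moreover have "norm (f (p + Suc i)) \<le> M * s ^ (2 * i + 2) * (1 / 2) ^ p" for p
  proof -
    have "s ^ (2 * (p + Suc i)) = s ^ (2 * i + 2) * s ^ (2 * p)"
      by (simp flip: power_add add: algebra_simps)
    also have "s ^ (2 * p) \<le> s ^ p"
      using s by (intro power_decreasing) auto
    also have "s ^ p \<le> (1 / 2) ^ p"
      using s by (intro power_mono) auto
    finally have "s ^ (2 * (p + Suc i)) \<le> s ^ (2 * i + 2) * (1 / 2) ^ p"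
      using s by (simp add: mult_left_mono)
    from order_trans[OF le mult_left_mono[OF this M]] show ?thesis
      by (simp add: mult.assoc)
  qed
  ultimately have "norm S \<le> M * s ^ (2 * i + 2) * 2"
    by (rule norm_sums_le)
  then show ?thesis
    by (simp add: mult_ac)
qed

text \<open>Inverse factorials beat every geometric sequence, and their weighted sums have the
  closed form \<open>exp s\<close>.\<close>

definition \<delta> :: "nat \<Rightarrow> real" where
  "\<delta> n = inverse (fact n)"

lemma \<delta>: "0 < \<delta> n" "\<delta> n \<le> 1"
  by (auto simp: \<delta>_def inverse_le_1_iff)

lemma
  shows abs_\<delta> [simp]: "\<bar>\<delta> n\<bar> = \<delta> n" and \<delta>_nonneg [simp]: "0 \<le> \<delta> n"
    and \<delta>_nonzero [simp]: "\<delta> n \<noteq> 0"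
  using \<delta>(1)[of n] by simp_all

lemma \<delta>_sums: "(\<lambda>n. \<delta> n * s ^ n) sums exp s" for s :: real
  using exp_converges[of s] by (simp add: \<delta>_def)

text \<open>The conditions on \<open>T (m i)\<close> are one-sided because \<open>m i\<close>
  precedes \<open>e i\<close> and \<open>f i\<close> and absorbs a prescribed vector, so that its
  image can be avoided only by later choices. \<open>small_e\<close> has a square because
  \<open>Q1\<close> divides by \<open>\<delta> n\<close>. \<open>total\<close> says that the closed
  span is everything, in the form needed to extend an identity of operators.\<close>

locale staircase_basis =
  fixes T :: "'a :: chilbert_space \<Rightarrow> 'a" and e f m :: "nat \<Rightarrow> 'a"
  assumes T: "bounded_clinear T"
    and norm_e: "norm (e n) = 1" and norm_f: "norm (f n) = 1" and norm_m: "m n = 0 \<or> norm (m n) = 1"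
    and e_e: "i \<noteq> j \<Longrightarrow> cinner (e i) (e j) = 0" and f_f: "i \<noteq> j \<Longrightarrow> cinner (f i) (f j) = 0"
    and m_m: "i \<noteq> j \<Longrightarrow> cinner (m i) (m j) = 0" and e_f: "cinner (e i) (f j) = 0"
    and e_m: "cinner (e i) (m j) = 0" and f_m: "cinner (f i) (m j) = 0"
    and Te_e: "i \<noteq> j \<Longrightarrow> cinner (T (e i)) (e j) = 0" and Te_f: "cinner (T (e i)) (f j) = 0"
    and Tf_e: "cinner (T (f i)) (e j) = 0" and Tf_f: "i \<noteq> j \<Longrightarrow> cinner (T (f i)) (f j) = 0"
    and Tm_e: "i \<le> j \<Longrightarrow> cinner (T (m i)) (e j) = 0" and Tm_f: "i \<le> j \<Longrightarrow> cinner (T (m i)) (f j) = 0"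
    and small_e: "norm (T (e n)) \<le> (\<delta> n)\<^sup>2"
    and small_f: "norm (cadjoint T (f n)) \<le> \<delta> n"
    and total: "\<lbrakk>complex_vector.subspace V; closed V; \<And>n. e n \<in> V; \<And>n. f n \<in> V; \<And>n. m n \<in> V\<rbrakk>
      \<Longrightarrow> x \<in> V"
begin

lemma
  shows f_e: "cinner (f i) (e j) = 0" and m_e: "cinner (m i) (e j) = 0" and m_f: "cinner (m i) (f j) = 0"
  using e_f e_m f_m cinner_eq_zero_swap by metis+

lemma norm_m_le: "norm (m n) \<le> 1"
  using norm_m[of n] by auto

lemma orthogonal_seqs [simp]:
  shows "orthogonal_seq e" "orthogonal_seq f" "orthogonal_seq m"
    "orthogonal_seq (\<lambda>n. e (2 * n))" "orthogonal_seq (\<lambda>n. e (Suc (2 * n)))"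
    "orthogonal_seq (\<lambda>n. of_real (\<delta> n) *\<^sub>C e (Suc (2 * n)))"
  using norm_e norm_f norm_m_le e_e f_f m_m \<delta>
  by (auto simp: orthogonal_seq_def norm_scaleC cinner_simps)

text \<open>The \<open>e\<close>'s go to odd and the \<open>f\<close>'s to even places because
  \<open>Suc (2 * n)\<close> exceeds \<open>n\<close> for all \<open>n\<close>, whereas
  \<open>2 * n\<close> would keep \<open>e 0\<close> in place.\<close>

definition Q2 :: "'a \<Rightarrow> 'a" where
  "Q2 x = synthesis e (\<lambda>n. of_real (\<delta> n) *\<^sub>C e (Suc (2 * n))) x + synthesis f (\<lambda>n. e (2 * n)) x
     + synthesis m f x"

lemma bounded_clinear_Q2: "bounded_clinear Q2"
  unfolding Q2_def
  by (intro bounded_clinear_plus bounded_clinear_synthesis[of _ 1] bessel_bound_orthogonal_seq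
      orthogonal_seqs)

lemmas Q2_single = cinner_synthesis_single[OF _ bessel_bound_orthogonal_seq]
lemmas Q2_zero = cinner_synthesis_zero[OF _ bessel_bound_orthogonal_seq]

lemma Q2_m: "cinner (Q2 y) (m k) = 0"
  unfolding Q2_def cinner_add_left by (simp add: Q2_zero e_m f_m cinner_simps)

lemma Q2_f: "cinner (Q2 y) (f k) = cinner y (m k)"
proof -
  have "cinner (synthesis m f y) (f k) = cinner y (m k)"
    using f_f by (subst Q2_single[where k = k]) (auto simp: cinner_self norm_f)
  then show ?thesis
    unfolding Q2_def cinner_add_left by (simp add: Q2_zero e_f cinner_simps)
qed

lemma Q2_e_even: "cinner (Q2 y) (e (2 * k)) = cinner y (f k)"
proof -
  have "cinner (synthesis f (\<lambda>n. e (2 * n)) y) (e (2 * k)) = cinner y (f k)"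
    using e_e by (subst Q2_single[where k = k]) (auto simp: cinner_self norm_e)
  moreover have "cinner (e (Suc (2 * n))) (e (2 * k)) = 0" for n
    by (rule e_e) presburger
  ultimately show ?thesis
    unfolding Q2_def cinner_add_left by (simp add: Q2_zero f_e cinner_simps)
qed

lemma Q2_e_odd: "cinner (Q2 y) (e (Suc (2 * k))) = of_real (\<delta> k) * cinner y (e k)"
proof -
  have "cinner (synthesis e (\<lambda>n. of_real (\<delta> n) *\<^sub>C e (Suc (2 * n))) y) (e (Suc (2 * k)))
      = of_real (\<delta> k) * cinner y (e k)"
    using e_e by (subst Q2_single[where k = k]) (auto simp: cinner_self norm_e cinner_simps)
  moreover have "cinner (e (2 * n)) (e (Suc (2 * k))) = 0" for n
    by (rule e_e) presburger
  ultimately show ?thesis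
    unfolding Q2_def cinner_add_left by (simp add: Q2_zero f_e)
qed

text \<open>Two applications remove all coordinates at the \<open>m\<close>'s and
  \<open>f\<close>'s. The rest moves up from \<open>k\<close> to \<open>2 * k + 1\<close>, so it
  shrinks by \<open>\<epsilon>\<close> when coordinate \<open>n\<close> is measured in units of
  \<open>s ^ n\<close> with \<open>s = 1 / \<epsilon>\<close>. These units grow, so every vector of
  the space is finite in them; returning to the norm is what needs \<open>\<delta>\<close>.\<close>

lemma power_decay_Q2: "power_decay Q2"
proof (rule power_decayI[OF bounded_clinear_Q2])
  fix \<epsilon> :: real
  assume \<epsilon>: "0 < \<epsilon>" "\<epsilon> < 1"
  define s where "s = 1 / \<epsilon>"
  have s: "s \<ge> 1" "\<epsilon> * s = 1"
    using \<epsilon> by (auto simp: s_def)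
  obtain B where B: "B > 0" "\<And>x. norm (Q2 x) \<le> B * norm x"
    using bounded_clinear_bound[OF bounded_clinear_Q2] by metis
  define E where "E t y \<longleftrightarrow> (\<forall>n. cinner y (m n) = 0 \<and> cinner y (f n) = 0 \<and>
    norm (cinner y (e n)) \<le> t * s ^ n)" for t y
  have step: "E (\<epsilon> * t) (Q2 y)" if y: "E t y" for t y
  proof -
    have t: "t \<ge> 0"
      using y norm_ge_zero order_trans unfolding E_def by (metis mult.right_neutral power_0)
    have "norm (cinner (Q2 y) (e n)) \<le> \<epsilon> * t * s ^ n" for n
    proof (cases "even n")
      case True
      then obtain k where "n = 2 * k"
        by (rule evenE)
      then show ?thesis
        using y t s \<epsilon> by (simp add: Q2_e_even E_def)
    next
      case False
      then obtain k where k: "n = Suc (2 * k)"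
        by (metis oddE Suc_eq_plus1)
      have "norm (cinner (Q2 y) (e n)) = \<delta> k * norm (cinner y (e k))"
        by (simp add: k Q2_e_odd norm_mult norm_inverse)
      also have "\<dots> \<le> 1 * (t * s ^ k)"
        using y \<delta>[of k] by (intro mult_mono) (auto simp: E_def)
      also have "\<dots> \<le> t * s ^ (2 * k)"
        using s t by (simp add: mult_left_mono power_increasing)
      also have "\<dots> = \<epsilon> * t * s ^ n"
        using s(2) by (simp add: k mult_ac)
      finally show ?thesis .
    qed
    then show ?thesis
      using y by (simp add: E_def Q2_m Q2_f)
  qed
  have init: "E (B\<^sup>2 * norm x) ((Q2 ^^ 2) x)" for x
  proof -
    have "norm (cinner ((Q2 ^^ 2) x) (e n)) \<le> B\<^sup>2 * norm x * s ^ n" for n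
    proof -
      have "norm (cinner ((Q2 ^^ 2) x) (e n)) \<le> norm ((Q2 ^^ 2) x)"
        using cauchy_schwarz[of _ "e n"] norm_e by (metis mult.right_neutral)
      also have "\<dots> \<le> B\<^sup>2 * norm x"
        using B by (intro norm_funpow_le) auto
      also have "\<dots> \<le> B\<^sup>2 * norm x * s ^ n"
        using mult_left_mono[OF one_le_power[OF s(1)], of "B\<^sup>2 * norm x" n] by simp
      finally show ?thesis .
    qed
    then show ?thesis
      by (simp add: E_def Q2_m Q2_f numeral_2_eq_2)
  qed
  have final: "norm (Q2 y) \<le> exp s * t" if y: "E t y" for t y
  proof -
    have "Q2 y = synthesis e (\<lambda>n. of_real (\<delta> n) *\<^sub>C e (Suc (2 * n))) y"
      using y by (simp add: Q2_def synthesis_eq_zero E_def)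
    also have "norm \<dots> \<le> (\<Sum>n. t * (\<delta> n * s ^ n))"
    proof (rule norm_synthesis_le_suminf)
      show "summable (\<lambda>n. t * (\<delta> n * s ^ n))"
        by (intro summable_mult sums_summable[OF \<delta>_sums])
      show "norm (cinner y (e n)) * norm (of_real (\<delta> n) *\<^sub>C e (Suc (2 * n))) \<le> t * (\<delta> n * s ^ n)" for n
        using y mult_right_mono[of "norm (cinner y (e n))" "t * s ^ n" "\<delta> n"]
        by (simp add: E_def norm_scaleC norm_e norm_inverse mult_ac)
    qed
    also have "\<dots> = t * exp s"
      using sums_unique[OF \<delta>_sums[of s]] suminf_mult[OF sums_summable[OF \<delta>_sums[of s]], of t] by simp
    finally show ?thesis
      by (simp add: mult.commute)
  qed
  show "\<exists>E k D C. (\<forall>t x. E t x \<longrightarrow> E (\<epsilon> * t) (Q2 x)) \<and>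
      (\<forall>x. E (D * norm x) ((Q2 ^^ k) x)) \<and> (\<forall>t x. E t x \<longrightarrow> norm (Q2 x) \<le> C * t)"
    using step init final by blast
qed

definition Q1 :: "'a \<Rightarrow> 'a" where
  "Q1 x = synthesis (\<lambda>n. e (Suc (2 * n))) (\<lambda>n. of_real (1 / \<delta> n) *\<^sub>C T (e n)) x
     + synthesis (\<lambda>n. e (2 * n)) (\<lambda>n. T (f n)) x + synthesis f (\<lambda>n. T (m n)) x"

lemma norm_rescaled_T_e: "norm (of_real (1 / \<delta> n) *\<^sub>C T (e n)) \<le> \<delta> n"
proof -
  have "norm (of_real (1 / \<delta> n) *\<^sub>C T (e n)) = (1 / \<delta> n) * norm (T (e n))"
    by (simp add: norm_scaleC norm_divide)
  also have "\<dots> \<le> (1 / \<delta> n) * (\<delta> n)\<^sup>2"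
    using \<delta>(1)[of n] by (intro mult_left_mono small_e) auto
  finally show ?thesis
    by (simp add: power2_eq_square)
qed

lemma bessel_bounds:
  obtains B where "B > 0" "\<And>x. norm (T x) \<le> B * norm x"
    "bessel_bound (exp 1) (\<lambda>n. of_real (1 / \<delta> n) *\<^sub>C T (e n))"
    "bessel_bound B (\<lambda>n. T (f n))" "bessel_bound B (\<lambda>n. T (m n))"
proof -
  obtain B where B: "B > 0" "\<And>x. norm (T x) \<le> B * norm x"
    using bounded_clinear_bound[OF T] by metis
  moreover have "bessel_bound (\<Sum>n. \<delta> n) (\<lambda>n. of_real (1 / \<delta> n) *\<^sub>C T (e n))"
    using sums_summable[OF \<delta>_sums[of 1]] by (intro bessel_bound_summable norm_rescaled_T_e) simp
  moreover have "(\<Sum>n. \<delta> n) = exp 1"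
    using sums_unique[OF \<delta>_sums[of 1]] by simp
  ultimately show ?thesis
    using that[of B] bessel_bound_image[OF T B(2)] by (simp del: of_real_divide)
qed

lemma bounded_clinear_Q1: "bounded_clinear Q1"
proof -
  obtain B where "bessel_bound (exp 1) (\<lambda>n. of_real (1 / \<delta> n) *\<^sub>C T (e n))"
    "bessel_bound B (\<lambda>n. T (f n))" "bessel_bound B (\<lambda>n. T (m n))"
    using bessel_bounds by metis
  then show ?thesis
    unfolding Q1_def by (intro bounded_clinear_plus bounded_clinear_synthesis) simp_all
qed

lemma Q1_e:
  "cinner (Q1 x) (e i) = cinner x (e (Suc (2 * i))) * cinner (of_real (1 / \<delta> i) *\<^sub>C T (e i)) (e i)
     + cinner (synthesis f (\<lambda>n. T (m n)) x) (e i)"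
proof -
  obtain B where B: "bessel_bound (exp 1) (\<lambda>n. of_real (1 / \<delta> n) *\<^sub>C T (e n))"
    "bessel_bound B (\<lambda>n. T (f n))"
    using bessel_bounds by metis
  have "cinner (synthesis (\<lambda>n. e (Suc (2 * n))) (\<lambda>n. of_real (1 / \<delta> n) *\<^sub>C T (e n)) x) (e i)
      = cinner x (e (Suc (2 * i))) * cinner (of_real (1 / \<delta> i) *\<^sub>C T (e i)) (e i)"
    using Te_e by (intro cinner_synthesis_single[OF _ B(1)]) (simp_all add: cinner_simps)
  moreover have "cinner (synthesis (\<lambda>n. e (2 * n)) (\<lambda>n. T (f n)) x) (e i) = 0"
    by (intro cinner_synthesis_zero[OF _ B(2)]) (simp_all add: Tf_e)
  ultimately show ?thesis
    by (simp add: Q1_def cinner_add_left del: of_real_divide)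
qed

lemma Q1_f:
  "cinner (Q1 x) (f j) = cinner x (e (2 * j)) * cinner (T (f j)) (f j)
     + cinner (synthesis f (\<lambda>n. T (m n)) x) (f j)"
proof -
  obtain B where B: "bessel_bound (exp 1) (\<lambda>n. of_real (1 / \<delta> n) *\<^sub>C T (e n))"
    "bessel_bound B (\<lambda>n. T (f n))"
    using bessel_bounds by metis
  have "cinner (synthesis (\<lambda>n. e (2 * n)) (\<lambda>n. T (f n)) x) (f j)
      = cinner x (e (2 * j)) * cinner (T (f j)) (f j)"
    using Tf_f by (intro cinner_synthesis_single[OF _ B(2)]) simp_all
  moreover have "cinner (synthesis (\<lambda>n. e (Suc (2 * n))) (\<lambda>n. of_real (1 / \<delta> n) *\<^sub>C T (e n)) x) (f j) = 0"
    by (intro cinner_synthesis_zero[OF _ B(1)]) (simp_all add: Te_f cinner_simps)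
  ultimately show ?thesis
    by (simp add: Q1_def cinner_add_left del: of_real_divide)
qed

text \<open>Turns the smallness of \<open>cadjoint T (f j)\<close> into decay of the
  \<open>f\<close>-coordinates of all vectors in \<open>range T\<close>.\<close>

lemma norm_cinner_T_f: "norm (cinner (T x) (f j)) \<le> norm x * \<delta> j"
  unfolding cadjoint[OF T]
  using order_trans[OF cauchy_schwarz mult_left_mono[OF small_f norm_ge_zero]] .

lemma norm_rescaled_T_e_e: "norm (cinner (of_real (1 / \<delta> i) *\<^sub>C T (e i)) (e i)) \<le> \<delta> i"
  using order_trans[OF cauchy_schwarz, of _ "e i"] norm_rescaled_T_e[of i]
  by (simp add: norm_e del: of_real_divide)

lemma norm_cinner_e_le: "norm (cinner x (e i)) \<le> norm x"
  using cauchy_schwarz[of x "e i"] by (simp add: norm_e)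

text \<open>
  Up to the \<open>m\<close>'s, \<open>Q1\<close> strictly lowers the rank if \<open>e i\<close> has rank \<open>2i + 1\<close> and \<open>f i\<close> has rank \<open>2i\<close>.
  So for small \<open>s\<close> it contracts by \<open>\<epsilon>\<close> when the coordinate of rank \<open>r\<close> is measured in units of \<open>s ^ r\<close>,
  and since \<open>\<delta>\<close> decays faster than any such weight, all of \<open>range (Q1\<^sup>2)\<close> is finite in these units.
\<close>
lemma power_decay_Q1: "power_decay Q1"
proof (rule power_decayI[OF bounded_clinear_Q1])
  fix \<epsilon> :: real
  assume \<epsilon>: "0 < \<epsilon>" "\<epsilon> < 1"
  obtain \<tau> where \<tau>: "\<tau> > 0" "\<And>x. norm (T x) \<le> \<tau> * norm x"
    and bound_m: "bessel_bound \<tau> (\<lambda>n. T (m n))"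
    using bessel_bounds by metis
  obtain B where B: "B > 0" "\<And>x. norm (Q1 x) \<le> B * norm x"
    using bounded_clinear_bound[OF bounded_clinear_Q1] by metis
  \<comment> \<open>The rows at \<open>e i\<close> will need
    \<open>s * (1 + 2 * \<tau>) \<le> \<epsilon>\<close>, the rows at \<open>f i\<close> need
    \<open>3 * s \<le> \<epsilon>\<close>, and the geometric tails need
    \<open>s \<le> 1 / 2\<close>.\<close>
  define s where "s = \<epsilon> / (3 + 2 * \<tau>)"
  have s: "0 < s" "s \<le> 1 / 2" "s * (1 + 2 * \<tau>) \<le> \<epsilon>" "3 * s \<le> \<epsilon>"
    using \<epsilon> \<tau>(1) by (auto simp: s_def field_simps)
  have s_power: "s ^ a \<le> s ^ b" if "b \<le> a" for a b
    using s that by (intro power_decreasing) auto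
  have norm_Tm: "norm (T (m p)) \<le> \<tau>" for p
    using order_trans[OF \<tau>(2) mult_left_mono[OF norm_m_le]] \<tau>(1) by simp
  have tail_e: "norm (cinner (synthesis f (\<lambda>n. T (m n)) x) (e i)) \<le> 2 * (t * \<tau>) * s ^ (2 * i + 2)"
    if "\<And>p. norm (cinner x (f p)) \<le> t * s ^ (2 * p)" for x t i
  proof (rule norm_sums_tail_le[OF cinner_synthesis_sums[OF _ bound_m]])
    show "norm (cinner x (f p) * cinner (T (m p)) (e i)) \<le> t * \<tau> * s ^ (2 * p)" for p
    proof -
      have "norm (cinner x (f p)) * norm (cinner (T (m p)) (e i)) \<le> (t * s ^ (2 * p)) * \<tau>"
        using order_trans[OF norm_cinner_e_le norm_Tm]
          order_trans[OF norm_ge_zero that[of p]] by (intro mult_mono that) auto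
      then show ?thesis
        by (simp add: norm_mult mult_ac)
    qed
  qed (use Tm_e s in auto)
  have tail_f: "norm (cinner (synthesis f (\<lambda>n. T (m n)) x) (f i)) \<le> 2 * t * s ^ (2 * i + 2)"
    if "\<And>p. norm (cinner x (f p)) \<le> t * s ^ (2 * p)" for x t i
  proof (rule norm_sums_tail_le[OF cinner_synthesis_sums[OF _ bound_m]])
    show "norm (cinner x (f p) * cinner (T (m p)) (f i)) \<le> t * s ^ (2 * p)" for p
    proof -
      have "norm (cinner (T (m p)) (f i)) \<le> norm (m p) * \<delta> i"
        by (rule norm_cinner_T_f)
      also have "\<dots> \<le> 1"
        using norm_m_le[of p] \<delta>[of i] by (simp add: mult_le_one)
      finally have "norm (cinner x (f p)) * norm (cinner (T (m p)) (f i)) \<le> (t * s ^ (2 * p)) * 1"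
        using order_trans[OF norm_ge_zero that[of p]] by (intro mult_mono that) auto
      then show ?thesis
        by (simp add: norm_mult)
    qed
  qed (use Tm_f s in auto)
  define E where "E t x \<longleftrightarrow> (\<forall>i. norm (cinner x (e i)) \<le> t * s ^ (2 * i + 1) \<and>
    norm (cinner x (f i)) \<le> t * s ^ (2 * i))" for t x
  have step: "E (\<epsilon> * t) (Q1 x)" if x: "E t x" for t x
    unfolding E_def
  proof (intro allI conjI)
    fix i
    have t: "t \<ge> 0"
      using x norm_ge_zero order_trans unfolding E_def by (metis mult.right_neutral power_0 mult_0_right)
    have xf: "\<And>p. norm (cinner x (f p)) \<le> t * s ^ (2 * p)"
      using x by (simp add: E_def)
    have "norm (cinner (Q1 x) (e i)) \<le> norm (cinner x (e (Suc (2 * i)))) * \<delta> i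
        + 2 * (t * \<tau>) * s ^ (2 * i + 2)"
      unfolding Q1_e using mult_left_mono[OF norm_rescaled_T_e_e[of i] norm_ge_zero]
      by (intro order_trans[OF norm_triangle_ineq] add_mono tail_e xf)
        (simp add: norm_mult del: of_real_divide)
    also have "norm (cinner x (e (Suc (2 * i)))) * \<delta> i \<le> (t * s ^ (2 * Suc (2 * i) + 1)) * 1"
      using x \<delta>[of i] t s by (intro mult_mono) (auto simp: E_def simp del: mult_Suc_right)
    also have "s ^ (2 * Suc (2 * i) + 1) \<le> s ^ (2 * i + 2)"
      by (rule s_power) simp
    finally have "norm (cinner (Q1 x) (e i)) \<le> t * s ^ (2 * i + 2) + 2 * (t * \<tau>) * s ^ (2 * i + 2)"
      using t by (simp add: mult_left_mono)
    also have "\<dots> = (s * (1 + 2 * \<tau>)) * (t * s ^ (2 * i + 1))"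
      by (simp add: algebra_simps)
    also have "\<dots> \<le> \<epsilon> * (t * s ^ (2 * i + 1))"
      using t s by (intro mult_right_mono) auto
    finally show "norm (cinner (Q1 x) (e i)) \<le> \<epsilon> * t * s ^ (2 * i + 1)"
      by (simp add: mult.assoc)
    \<comment> \<open>The coordinate at \<open>e (2 * i)\<close> has rank \<open>4 * i + 1\<close>,
      which exceeds the rank \<open>2 * i\<close> of \<open>f i\<close> even at
      \<open>i = 0\<close>; this is why the \<open>e\<close>'s have odd rank.\<close>
    have "norm (cinner (Q1 x) (f i)) \<le> norm (cinner x (e (2 * i))) * norm (cinner (T (f i)) (f i))
        + 2 * t * s ^ (2 * i + 2)"
      unfolding Q1_f by (intro order_trans[OF norm_triangle_ineq] add_mono tail_f xf)
        (simp add: norm_mult)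
    also have "norm (cinner x (e (2 * i))) * norm (cinner (T (f i)) (f i)) \<le> (t * s ^ (2 * (2 * i) + 1)) * 1"
    proof (rule mult_mono)
      show "norm (cinner x (e (2 * i))) \<le> t * s ^ (2 * (2 * i) + 1)"
        using x unfolding E_def by blast
      show "norm (cinner (T (f i)) (f i)) \<le> 1"
        using norm_cinner_T_f[of "f i" i] \<delta>(2)[of i] by (simp add: norm_f)
    qed (use t s in auto)
    also have "s ^ (2 * (2 * i) + 1) \<le> s ^ (2 * i + 1)"
      by (rule s_power) simp
    also have "s ^ (2 * i + 2) \<le> s ^ (2 * i + 1)"
      by (rule s_power) simp
    finally have "norm (cinner (Q1 x) (f i)) \<le> (3 * s) * (t * s ^ (2 * i))"
      using t by (simp add: algebra_simps mult_right_mono)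
    also have "\<dots> \<le> \<epsilon> * (t * s ^ (2 * i))"
      using t s by (intro mult_right_mono) auto
    finally show "norm (cinner (Q1 x) (f i)) \<le> \<epsilon> * t * s ^ (2 * i)"
      by (simp add: mult.assoc)
  qed
  \<comment> \<open>A single term of the series of \<open>exp (1 / s\<^sup>2)\<close> gives
    \<open>\<delta> j \<le> exp (1 / s\<^sup>2) * s ^ (2 * j)\<close>; the further
    \<open>1 / s\<close> pays for the odd rank.\<close>
  define D where "D = exp (1 / s\<^sup>2) / s"
  have D: "D > 0" "\<delta> j \<le> D * s ^ (2 * j + 1)" for j
  proof -
    show "D > 0"
      using s by (simp add: D_def)
    have "\<delta> j * (1 / s\<^sup>2) ^ j \<le> exp (1 / s\<^sup>2)"
    proof -
      have "(\<Sum>n\<in>{j}. \<delta> n * (1 / s\<^sup>2) ^ n) \<le> (\<Sum>n. \<delta> n * (1 / s\<^sup>2) ^ n)"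
        using s by (intro sum_le_suminf sums_summable[OF \<delta>_sums]) auto
      then show ?thesis
        using sums_unique[OF \<delta>_sums[of "1 / s\<^sup>2"]] by simp
    qed
    then show "\<delta> j \<le> D * s ^ (2 * j + 1)"
      using s(1) by (simp add: D_def power_divide power_one_over field_simps flip: power_mult)
  qed
  have D': "\<delta> j \<le> D * s ^ (2 * j)" for j
  proof -
    have "D * s ^ (2 * j + 1) \<le> D * s ^ (2 * j)"
      using D(1) by (intro mult_left_mono s_power) auto
    then show ?thesis
      using D(2)[of j] by linarith
  qed
  have init_f: "norm (cinner (Q1 x) (f j)) \<le> (2 * D * norm x) * s ^ (2 * j)" for x j
  proof -
    have "cinner (synthesis f (\<lambda>n. T (m n)) x) (f j) = cinner (T (synthesis f m x)) (f j)"
      by (simp add: synthesis_image T)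
    then have "norm (cinner (synthesis f (\<lambda>n. T (m n)) x) (f j)) \<le> norm (synthesis f m x) * \<delta> j"
      using norm_cinner_T_f by metis
    also have "\<dots> \<le> norm x * \<delta> j"
      using norm_synthesis_le[OF _ bessel_bound_orthogonal_seq, of f m x] \<delta>[of j]
      by (intro mult_right_mono) auto
    finally have "norm (cinner (synthesis f (\<lambda>n. T (m n)) x) (f j)) \<le> norm x * \<delta> j" .
    moreover have "norm (cinner x (e (2 * j)) * cinner (T (f j)) (f j)) \<le> norm x * \<delta> j"
      unfolding norm_mult using norm_cinner_T_f[of "f j" j] norm_f[of j]
      by (intro mult_mono norm_cinner_e_le) auto
    ultimately have "norm (cinner (Q1 x) (f j)) \<le> 2 * norm x * \<delta> j"
      unfolding Q1_f using norm_triangle_ineq[of "cinner x (e (2 * j)) * cinner (T (f j)) (f j)"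
          "cinner (synthesis f (\<lambda>n. T (m n)) x) (f j)"] by linarith
    also have "\<dots> \<le> 2 * norm x * (D * s ^ (2 * j))"
      by (intro mult_left_mono D') auto
    finally show ?thesis
      by (simp add: mult_ac)
  qed
  \<comment> \<open>The second application is needed for the \<open>e\<close>-coordinates: their
    part coming from the \<open>m\<close>'s is a tail over \<open>f\<close>-coordinates, and only
    those of \<open>Q1 x\<close> are known to decay, by \<open>init_f\<close>.\<close>
  have init: "E ((B * D + 4 * D * \<tau> + 2 * D * B) * norm x) ((Q1 ^^ 2) x)" for x
  proof -
    let ?y = "Q1 x"
    have pos: "0 \<le> B * D" "0 \<le> D * \<tau>"
      using B(1) D(1) \<tau>(1) by auto
    have "norm (cinner (Q1 ?y) (e i)) \<le> (B * D + 4 * D * \<tau> + 2 * D * B) * norm x * s ^ (2 * i + 1)" for i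
    proof -
      have "norm (cinner (Q1 ?y) (e i)) \<le> norm (cinner ?y (e (Suc (2 * i)))) * \<delta> i
          + 2 * ((2 * D * norm x) * \<tau>) * s ^ (2 * i + 2)"
        unfolding Q1_e using mult_left_mono[OF norm_rescaled_T_e_e[of i] norm_ge_zero]
        by (intro order_trans[OF norm_triangle_ineq] add_mono tail_e init_f)
          (simp add: norm_mult del: of_real_divide)
      also have "norm (cinner ?y (e (Suc (2 * i)))) * \<delta> i \<le> (B * norm x) * (D * s ^ (2 * i + 1))"
        using order_trans[OF norm_cinner_e_le B(2)] B(1) by (intro mult_mono D) auto
      also have "s ^ (2 * i + 2) \<le> s ^ (2 * i + 1)"
        by (rule s_power) simp
      finally have "norm (cinner (Q1 ?y) (e i)) \<le> (B * D + 4 * D * \<tau>) * (norm x * s ^ (2 * i + 1))"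
        using pos less_imp_le[OF D(1)] less_imp_le[OF \<tau>(1)]
        by (simp add: algebra_simps mult_right_mono)
      also have "\<dots> \<le> (B * D + 4 * D * \<tau> + 2 * D * B) * (norm x * s ^ (2 * i + 1))"
        using pos s by (intro mult_right_mono) (auto simp: mult.commute)
      finally show ?thesis
        by (simp add: mult.assoc)
    qed
    moreover have "norm (cinner (Q1 ?y) (f i)) \<le> (B * D + 4 * D * \<tau> + 2 * D * B) * norm x * s ^ (2 * i)" for i
    proof -
      have "norm (cinner (Q1 ?y) (f i)) \<le> (2 * D * norm ?y) * s ^ (2 * i)"
        by (rule init_f)
      also have "\<dots> \<le> (2 * D * (B * norm x)) * s ^ (2 * i)"
        using D(1) s by (intro mult_right_mono mult_left_mono B) auto
      also have "\<dots> = (2 * D * B) * (norm x * s ^ (2 * i))"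
        by simp
      also have "\<dots> \<le> (B * D + 4 * D * \<tau> + 2 * D * B) * (norm x * s ^ (2 * i))"
        using pos s by (intro mult_right_mono) auto
      finally show ?thesis
        by (simp add: mult.assoc)
    qed
    ultimately show ?thesis
      by (simp add: E_def numeral_2_eq_2)
  qed
  have final: "norm (Q1 x) \<le> (2 + 4 * \<tau>) * t" if x: "E t x" for t x
  proof -
    have t: "t \<ge> 0"
      using x norm_ge_zero order_trans unfolding E_def by (metis mult.right_neutral power_0 mult_0_right)
    have geo: "summable (\<lambda>n. c * (1 / 2 :: real) ^ n)" "(\<Sum>n. c * (1 / 2 :: real) ^ n) = 2 * c" for c
      using suminf_mult[OF summable_geometric[of "1 / 2 :: real"], of c]
        suminf_geometric[of "1 / 2 :: real"] by (auto intro!: summable_mult summable_geometric)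
    have half: "s ^ a \<le> (1 / 2) ^ n" if "n \<le> a" for a n
      using s order_trans[OF s_power[OF that] power_mono[of s "1 / 2" n]] by simp
    have xe: "norm (cinner x (e k)) \<le> t * (1 / 2) ^ n" if "n \<le> k" for k n
    proof -
      have "norm (cinner x (e k)) \<le> t * s ^ (2 * k + 1)"
        using x by (simp add: E_def)
      also have "\<dots> \<le> t * (1 / 2) ^ n"
        using that t by (intro mult_left_mono half) auto
      finally show ?thesis .
    qed
    have xf: "norm (cinner x (f n)) \<le> t * (1 / 2) ^ n" for n
    proof -
      have "norm (cinner x (f n)) \<le> t * s ^ (2 * n)"
        using x by (simp add: E_def)
      also have "\<dots> \<le> t * (1 / 2) ^ n"
        using t by (intro mult_left_mono half) auto
      finally show ?thesis .
    qed
    have bound: "norm (synthesis b w x) \<le> 2 * (c * t)"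
      if "\<And>n. norm (cinner x (b n)) \<le> t * (1 / 2) ^ n" "\<And>n. norm (w n) \<le> c" for b w c
    proof -
      have "norm (synthesis b w x) \<le> (\<Sum>n. (c * t) * (1 / 2) ^ n)"
      proof (rule norm_synthesis_le_suminf[OF geo(1)])
        show "norm (cinner x (b n)) * norm (w n) \<le> (c * t) * (1 / 2) ^ n" for n
          using mult_mono[OF that(1)[of n] that(2)[of n]] t by (simp add: mult_ac)
      qed
      then show ?thesis
        by (simp add: geo(2))
    qed
    have "norm (Q1 x) \<le> 2 * (1 * t) + 2 * (\<tau> * t) + 2 * (\<tau> * t)"
      unfolding Q1_def
    proof (intro order_trans[OF norm_triangle_ineq] add_mono bound)
      show "norm (of_real (1 / \<delta> n) *\<^sub>C T (e n)) \<le> 1" for n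
        using norm_rescaled_T_e[of n] \<delta>(2)[of n] by linarith
      show "norm (T (f n)) \<le> \<tau>" for n
        using \<tau>(2)[of "f n"] by (simp add: norm_f)
    qed (use xe xf norm_Tm in auto)
    then show ?thesis
      by (simp add: algebra_simps)
  qed
  show "\<exists>E k D C. (\<forall>t x. E t x \<longrightarrow> E (\<epsilon> * t) (Q1 x)) \<and>
      (\<forall>x. E (D * norm x) ((Q1 ^^ k) x)) \<and> (\<forall>t x. E t x \<longrightarrow> norm (Q1 x) \<le> C * t)"
    using step init final by blast
qed

lemma factorization: "T = Q1 \<circ> Q2"
proof
  fix x
  note Q1Q2 = bounded_clinear_compose[OF bounded_clinear_Q1 bounded_clinear_Q2]
  have one: "cinner (e n) (e n) = 1" "cinner (f n) (f n) = 1" for n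
    by (simp_all add: cinner_self norm_e norm_f)
  let ?V = "{x. Q1 (Q2 x) = T x}"
  have "x \<in> ?V"
  proof (rule total)
    show "complex_vector.subspace ?V"
      by (auto simp: complex_vector.subspace_def bounded_clinear_add[OF Q1Q2] bounded_clinear_add[OF T]
          bounded_clinear_scaleC[OF Q1Q2] bounded_clinear_scaleC[OF T]
          bounded_clinear_zero[OF Q1Q2] bounded_clinear_zero[OF T])
    show "closed ?V"
      by (intro closed_Collect_eq linear_continuous_on bounded_clinear_bounded_linear Q1Q2 T)
    have Q1_f_n: "Q1 (f n) = T (m n)" for n
      using synthesis_basis[of f "\<lambda>n. T (m n)" n]
      by (simp add: Q1_def synthesis_eq_zero f_e one scaleC_one)
    have Q1_e_even: "Q1 (e (2 * n)) = T (f n)" for n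
    proof -
      have "cinner (e (2 * n)) (e (Suc (2 * k))) = 0" for k
        by (rule e_e) presburger
      then show ?thesis
        using synthesis_basis[of "\<lambda>n. e (2 * n)" "\<lambda>n. T (f n)" n]
        by (simp add: Q1_def synthesis_eq_zero e_f one scaleC_one)
    qed
    have Q1_e_odd: "Q1 (e (Suc (2 * n))) = of_real (1 / \<delta> n) *\<^sub>C T (e n)" for n
    proof -
      have "cinner (e (Suc (2 * n))) (e (2 * k)) = 0" for k
        by (rule e_e) presburger
      then show ?thesis
        using synthesis_basis[of "\<lambda>n. e (Suc (2 * n))" "\<lambda>n. of_real (1 / \<delta> n) *\<^sub>C T (e n)" n]
        by (simp add: Q1_def synthesis_eq_zero e_f one scaleC_one)
    qed
    show "e n \<in> ?V" for n
    proof -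
      have "Q2 (e n) = of_real (\<delta> n) *\<^sub>C e (Suc (2 * n))"
        using synthesis_basis[of e "\<lambda>n. of_real (\<delta> n) *\<^sub>C e (Suc (2 * n))" n]
        by (simp add: Q2_def synthesis_eq_zero e_f e_m one scaleC_one)
      then show ?thesis
        by (simp add: bounded_clinear_scaleC[OF bounded_clinear_Q1] Q1_e_odd scaleC_scaleC scaleC_one)
    qed
    show "f n \<in> ?V" for n
    proof -
      have "Q2 (f n) = e (2 * n)"
        using synthesis_basis[of f "\<lambda>n. e (2 * n)" n]
        by (simp add: Q2_def synthesis_eq_zero f_e f_m one scaleC_one)
      then show ?thesis
        by (simp add: Q1_e_even)
    qed
    show "m n \<in> ?V" for n
    proof (cases "m n = 0")
      case True
      then show ?thesis
        by (simp add: bounded_clinear_zero[OF Q1Q2] bounded_clinear_zero[OF T])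
    next
      case False
      then have "cinner (m n) (m n) = 1"
        using norm_m[of n] by (auto simp: cinner_self)
      then have "Q2 (m n) = f n"
        using synthesis_basis[of m f n] by (simp add: Q2_def synthesis_eq_zero m_e m_f scaleC_one)
      then show ?thesis
        by (simp add: Q1_f_n)
    qed
  qed
  then show "T x = (Q1 \<circ> Q2) x"
    by simp
qed

end

section \<open>Construction of a staircase basis\<close>

lemma exists_small_unit_vector:
  fixes S :: "'a :: chilbert_space \<Rightarrow> 'a"
  assumes S: "bounded_clinear S" "\<not> cofinitely_bounded_below S" and G: "finite G" and \<epsilon>: "\<epsilon> > 0"
  obtains u where "norm u = 1" "u \<in> orthogonal_space G" "norm (S u) \<le> \<epsilon>"
proof -
  have "\<not> (\<forall>x. (\<forall>g\<in>G. cinner x g = 0) \<longrightarrow> \<epsilon> * norm x \<le> norm (S x))"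
    using S(2) G \<epsilon> unfolding cofinitely_bounded_below_def by blast
  then obtain x where x: "x \<in> orthogonal_space G" "norm (S x) < \<epsilon> * norm x"
    by (auto simp: not_le)
  have x0: "norm x > 0"
    using x(2) norm_ge_zero[of "S x"] \<epsilon> by (metis less_le_not_le mult_zero_right norm_zero zero_less_norm_iff)
  define u where "u = of_real (1 / norm x) *\<^sub>C x"
  have "norm (S u) = norm (S x) / norm x"
    by (simp add: u_def bounded_clinear_scaleC[OF S(1)] norm_scaleC norm_divide)
  then have "norm (S u) \<le> \<epsilon>"
    using x(2) x0 by (simp add: divide_le_eq)
  moreover have "norm u = 1" "u \<in> orthogonal_space G"
    using x(1) x0 by (auto simp: u_def norm_scaleC norm_divide cinner_simps)
  ultimately show ?thesis
    using that by blast
qed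

text \<open>0 is exempted from orthonormality because an earlier step may have produced it, its
  vector being already in the span.\<close>

lemma gram_schmidt_vector:
  assumes H: "finite H" "corthonormal (H - {0})"
  obtains u where "u \<in> orthogonal_space H" "u = 0 \<or> norm u = 1" "x \<in> complex_vector.span (insert u H)"
proof -
  define s where "s = (\<Sum>h\<in>H - {0}. cinner x h *\<^sub>C h)"
  define u where "u = of_real (1 / norm (x - s)) *\<^sub>C (x - s)"
  have "cinner (x - s) h = 0" if "h \<in> H" for h
    using gram_schmidt_step[OF _ H(2), of h x] H(1) that by (cases "h = 0") (auto simp: s_def)
  then have "u \<in> orthogonal_space H"
    by (simp add: u_def cinner_simps)
  moreover have "u = 0 \<or> norm u = 1"
    by (simp add: u_def norm_scaleC norm_divide)
  moreover have "x \<in> complex_vector.span (insert u H)"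
  proof -
    have "s \<in> complex_vector.span (insert u H)"
      unfolding s_def
      by (intro complex_vector.span_sum complex_vector.span_scale complex_vector.span_base) auto
    moreover have "of_real (norm (x - s)) *\<^sub>C u \<in> complex_vector.span (insert u H)"
      by (intro complex_vector.span_scale complex_vector.span_base) auto
    moreover have "x = s + of_real (norm (x - s)) *\<^sub>C u"
      by (cases "x = s") (simp_all add: u_def scaleC_scaleC scaleC_one)
    ultimately show ?thesis
      using complex_vector.span_add by metis
  qed
  ultimately show ?thesis
    by (rule that)
qed

lemma corthonormal_insert:
  assumes H: "corthonormal (H - {0})" and u: "u \<in> orthogonal_space H" "u = 0 \<or> norm u = 1"
  shows "corthonormal (insert u H - {0})"
proof (cases "u = 0")
  case True
  then show ?thesis
    using H by simp
next
  case False
  have "cinner u h = 0 \<and> cinner h u = 0" if "h \<in> H" for h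
    using u(1) that cinner_eq_zero_swap[of h u] by simp
  moreover from this False have "u \<notin> H"
    by (metis cinner_self_zero)
  moreover have "cinner u u = 1"
    using u(2) False by (simp add: cinner_self)
  ultimately show ?thesis
    using H unfolding corthonormal_def by (metis DiffD1 DiffD2 DiffI insertE)
qed

text \<open>The vectors chosen at the steps \<open>3n\<close>, \<open>3n + 1\<close>, \<open>3n + 2\<close> become \<open>m n\<close>, \<open>e n\<close>, \<open>f n\<close>.\<close>
definition admissible_step ::
    "('a :: chilbert_space \<Rightarrow> 'a) \<Rightarrow> (nat \<Rightarrow> 'a) \<Rightarrow> 'a set \<Rightarrow> nat \<Rightarrow> 'a \<Rightarrow> bool" where
  "admissible_step T x H l u \<longleftrightarrow> u \<in> orthogonal_space H \<and> (u = 0 \<or> norm u = 1) \<and>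
     (l mod 3 = 0 \<longrightarrow> x (l div 3) \<in> complex_vector.span (insert u H)) \<and>
     (l mod 3 \<noteq> 0 \<longrightarrow> norm u = 1 \<and> (\<forall>h\<in>H. cinner u (T h) = 0 \<and> cinner u (cadjoint T h) = 0)) \<and>
     (l mod 3 = 1 \<longrightarrow> norm (T u) \<le> (\<delta> (l div 3))\<^sup>2) \<and>
     (l mod 3 = 2 \<longrightarrow> norm (cadjoint T u) \<le> (\<delta> (l div 3))\<^sup>2)"

lemma exists_admissible_step:
  assumes T: "bounded_clinear T" "\<not> cofinitely_bounded_below T"
      "\<not> cofinitely_bounded_below (cadjoint T)"
    and H: "finite H" "corthonormal (H - {0})"
  shows "\<exists>u. admissible_step T x H l u"
proof (cases "l mod 3 = 0")
  case True
  obtain u where "u \<in> orthogonal_space H" "u = 0 \<or> norm u = 1"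
    "x (l div 3) \<in> complex_vector.span (insert u H)"
    by (rule gram_schmidt_vector[OF H])
  then show ?thesis
    using True by (intro exI[of _ u]) (simp add: admissible_step_def)
next
  case False
  define S where "S = (if l mod 3 = 1 then T else cadjoint T)"
  have S: "bounded_clinear S" "\<not> cofinitely_bounded_below S"
    using T bounded_clinear_cadjoint by (auto simp: S_def)
  \<comment> \<open>The lower bound fails on the complement of every finite set, so images under
    \<open>T\<close> and \<open>cadjoint T\<close> can be avoided at once.\<close>
  have "finite (H \<union> T ` H \<union> cadjoint T ` H)" "(\<delta> (l div 3))\<^sup>2 > 0"
    using H(1) by auto
  then obtain u where "norm u = 1" "u \<in> orthogonal_space (H \<union> T ` H \<union> cadjoint T ` H)"
    "norm (S u) \<le> (\<delta> (l div 3))\<^sup>2"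
    by (rule exists_small_unit_vector[OF S])
  then show ?thesis
    using False by (intro exI[of _ u]) (auto simp: admissible_step_def S_def)
qed

lemma exists_staircase_basis:
  fixes T :: "'a :: chilbert_space \<Rightarrow> 'a" and x :: "nat \<Rightarrow> 'a"
  assumes T: "bounded_clinear T" "\<not> cofinitely_bounded_below T"
      "\<not> cofinitely_bounded_below (cadjoint T)"
    and dense: "closure (range x) = UNIV"
  obtains e f m where "staircase_basis T e f m"
proof -
  \<comment> \<open>The choice depends only on the set of earlier vectors and the step number. An
    admissible vector is guaranteed only for a finite, orthonormal history, so this invariant is
    carried through the recursion.\<close>
  define ch where "ch H l = (SOME u. admissible_step T x H l u)" for H l
  define hist where "hist = rec_nat {} (\<lambda>l H. insert (ch H l) H)"
  define b where "b l = ch (hist l) l" for l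
  have hist_0: "hist 0 = {}" and hist_Suc: "hist (Suc l) = insert (b l) (hist l)" for l
    by (simp_all add: hist_def b_def)
  have hist: "finite (hist l) \<and> corthonormal (hist l - {0}) \<and> hist l = b ` {..<l}" for l
  proof (induction l)
    case 0
    then show ?case
      by (simp add: hist_0 corthonormal_def)
  next
    case (Suc l)
    have "admissible_step T x (hist l) l (b l)"
      unfolding b_def ch_def using someI_ex[OF exists_admissible_step[OF T]] Suc by blast
    then have b: "\<forall>h\<in>hist l. cinner (b l) h = 0" and b': "b l = 0 \<or> norm (b l) = 1"
      by (auto simp: admissible_step_def)
    then have "corthonormal (hist (Suc l) - {0})"
      unfolding hist_Suc using Suc by (intro corthonormal_insert) auto
    then show ?case
      using Suc by (simp add: hist_Suc lessThan_Suc)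
  qed
  have step: "admissible_step T x (hist l) l (b l)" for l
    unfolding b_def ch_def using someI_ex[OF exists_admissible_step[OF T]] hist by blast
  have less: "b k \<in> hist l" if "k < l" for k l
    using hist that by auto
  have b_b: "cinner (b k) (b l) = 0" if "k \<noteq> l" for k l
    using that
  proof (induction k l rule: linorder_wlog)
    case (le k l)
    then have "cinner (b l) (b k) = 0"
      using step[of l] less[of k l] by (auto simp: admissible_step_def)
    then show ?case
      by (simp add: cinner_eq_zero_swap)
  next
    case (sym k l)
    then show ?case
      by (auto simp: cinner_eq_zero_swap)
  qed
  \<comment> \<open>Only the later of the two vectors must be an \<open>e\<close> or an
    \<open>f\<close>. If it is \<open>b l\<close>, it avoids \<open>T (b k)\<close>; if it is
    \<open>b k\<close>, it avoids \<open>cadjoint T (b l)\<close>, and \<open>T\<close> is moved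
    across the inner product.\<close>
  have Tb_b: "cinner (T (b k)) (b l) = 0" if "k < l \<and> l mod 3 \<noteq> 0 \<or> l < k \<and> k mod 3 \<noteq> 0" for k l
    using that
  proof
    assume "k < l \<and> l mod 3 \<noteq> 0"
    then have "cinner (b l) (T (b k)) = 0"
      using step[of l] less[of k l] by (auto simp: admissible_step_def)
    then show ?thesis
      by (simp add: cinner_eq_zero_swap)
  next
    assume "l < k \<and> k mod 3 \<noteq> 0"
    then have "cinner (b k) (cadjoint T (b l)) = 0"
      using step[of k] less[of l k] by (auto simp: admissible_step_def)
    then show ?thesis
      by (simp add: cadjoint[OF T(1)])
  qed
  have mods: "(3 * n + 1) mod 3 = 1" "(3 * n + 2) mod 3 = 2" "(3 * n) mod 3 = 0"
    "(3 * n + 1) div 3 = n" "(3 * n + 2) div 3 = n" "(3 * n) div 3 = n" for n :: nat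
    by presburger+
  have neqs: "3 * i + 1 \<noteq> 3 * j + 2" "3 * i + 1 \<noteq> 3 * j" "3 * i + 2 \<noteq> 3 * j" for i j :: nat
    by presburger+
  have nonzero_mod: "(3 * n + 1) mod 3 \<noteq> 0" "(3 * n + 2) mod 3 \<noteq> 0" for n :: nat
    by presburger+
  define e f m where "e n = b (3 * n + 1)" and "f n = b (3 * n + 2)" and "m n = b (3 * n)" for n
  have Tb_b': "cinner (T (b k)) (b l) = 0" if "k \<noteq> l" "k mod 3 \<noteq> 0" "l mod 3 \<noteq> 0" for k l
    using that by (intro Tb_b) auto
  have "staircase_basis T e f m"
  proof
    show "bounded_clinear T"
      by (rule T)
    show "norm (e n) = 1" for n
      using step[of "3 * n + 1"] unfolding admissible_step_def mods e_def by simp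
    show "norm (f n) = 1" for n
      using step[of "3 * n + 2"] unfolding admissible_step_def mods f_def by simp
    show "m n = 0 \<or> norm (m n) = 1" for n
      using step[of "3 * n"] unfolding admissible_step_def mods m_def by simp
    show "cinner (e i) (e j) = 0" "cinner (f i) (f j) = 0" "cinner (m i) (m j) = 0" if "i \<noteq> j" for i j
      unfolding e_def f_def m_def using that by (intro b_b; simp)+
    show "cinner (e i) (f j) = 0" "cinner (e i) (m j) = 0" "cinner (f i) (m j) = 0" for i j
      unfolding e_def f_def m_def by (intro b_b neqs)+
    show "cinner (T (e i)) (e j) = 0" "cinner (T (f i)) (f j) = 0" if "i \<noteq> j" for i j
      unfolding e_def f_def using that by (intro Tb_b' nonzero_mod; simp)+
    show "cinner (T (e i)) (f j) = 0" for i j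
      unfolding e_def f_def by (intro Tb_b' nonzero_mod neqs)
    show "cinner (T (f i)) (e j) = 0" for i j
      unfolding e_def f_def by (intro Tb_b' nonzero_mod neqs[symmetric])
    show "cinner (T (m i)) (e j) = 0" "cinner (T (m i)) (f j) = 0" if "i \<le> j" for i j
      unfolding e_def f_def m_def using that
      by (intro Tb_b disjI1 conjI nonzero_mod; simp)+
    show "norm (T (e n)) \<le> (\<delta> n)\<^sup>2" for n
      using step[of "3 * n + 1"] unfolding admissible_step_def mods e_def by simp
    show "norm (cadjoint T (f n)) \<le> \<delta> n" for n
    proof -
      have "norm (cadjoint T (f n)) \<le> (\<delta> n)\<^sup>2"
        using step[of "3 * n + 2"] unfolding admissible_step_def mods f_def by simp
      also have "\<dots> \<le> \<delta> n"
        using \<delta>[of n] by (simp add: power2_eq_square mult_left_le)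
      finally show ?thesis .
    qed
    show "y \<in> V" if V: "complex_vector.subspace V" "closed V"
      and emf: "\<And>n. e n \<in> V" "\<And>n. f n \<in> V" "\<And>n. m n \<in> V" for V y
    proof -
      have "b l \<in> V" for l
      proof -
        have "l = 3 * (l div 3) \<or> l = 3 * (l div 3) + 1 \<or> l = 3 * (l div 3) + 2"
          by presburger
        then show ?thesis
          using emf unfolding e_def f_def m_def by metis
      qed
      then have "insert (b l) (hist l) \<subseteq> V" for l
        using hist by auto
      then have span: "complex_vector.span (insert (b l) (hist l)) \<subseteq> V" for l
        using V(1) by (rule complex_vector.span_minimal)
      have "x n \<in> V" for n
        using span[of "3 * n"] step[of "3 * n"] unfolding admissible_step_def mods by blast
      then have "closure (range x) \<subseteq> V"
        using V(2) by (intro closure_minimal) auto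
      then show ?thesis
        using dense by auto
    qed
  qed
  then show ?thesis
    by (rule that)
qed

theorem theorem2p3:
  fixes T :: "'a :: chilbert_space \<Rightarrow> 'a"
  assumes separable: "separable_space (euclidean :: 'a topology)"
    and infinite_dimensional: "\<not> finite_cdim (UNIV :: 'a set)"
    and bounded_operator: "bounded_clinear T"
  shows "(\<exists>Q1 Q2. quasinilpotent Q1 \<and> quasinilpotent Q2 \<and> T = Q1 \<circ> Q2)
     \<longleftrightarrow> \<not> semi_Fredholm T"
proof
  assume "\<exists>Q1 Q2. quasinilpotent Q1 \<and> quasinilpotent Q2 \<and> T = Q1 \<circ> Q2"
  then obtain Q1 Q2 where Q: "quasinilpotent Q1" "quasinilpotent Q2" and TQ: "T = Q1 \<circ> Q2"
    by blast
  have Q1: "bounded_clinear Q1" and Q2: "bounded_clinear Q2"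
    using Q by (auto simp: quasinilpotent_def)
  have factor: "cofinitely_bounded_below S" if R: "bounded_clinear R" and RS: "cofinitely_bounded_below (R \<circ> S)"
    for R S :: "'a \<Rightarrow> 'a"
  proof -
    obtain B where B: "B > 0" "\<And>x. norm (R x) \<le> B * norm x"
      using bounded_clinear_bound[OF R] by metis
    obtain G c where G: "finite G" "c > 0"
      and lower: "\<And>x. \<forall>g\<in>G. cinner x g = 0 \<Longrightarrow> c * norm x \<le> norm (R (S x))"
      using RS by (auto simp: cofinitely_bounded_below_def)
    have "c / B * norm x \<le> norm (S x)" if "\<forall>g\<in>G. cinner x g = 0" for x
      using order_trans[OF lower[OF that] B(2)] B(1) by (simp add: field_simps)
    then show ?thesis
      using G B(1) unfolding cofinitely_bounded_below_def by (metis divide_pos_pos)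
  qed
  have "\<not> cofinitely_bounded_below T"
    using factor[OF Q1] TQ power_decay_not_cofinitely_bounded_below[OF infinite_dimensional Q2
        quasinilpotent_power_decay[OF Q(2)]] by blast
  moreover have "\<not> cofinitely_bounded_below (cadjoint T)"
  proof -
    \<comment> \<open>The order is reversed, so the inner factor that inherits the lower bound is
      now the adjoint of \<open>Q1\<close>.\<close>
    have "cadjoint T = cadjoint Q2 \<circ> cadjoint Q1"
      using cadjoint_compose[OF Q1 Q2] by (auto simp: TQ)
    then show ?thesis
      using factor[OF bounded_clinear_cadjoint[OF Q2]] power_decay_not_cofinitely_bounded_below
        [OF infinite_dimensional bounded_clinear_cadjoint[OF Q1]
          power_decay_cadjoint[OF Q1 quasinilpotent_power_decay[OF Q(1)]]] by metis
  qed
  ultimately show "\<not> semi_Fredholm T"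
    by (simp add: semi_Fredholm_def upper_semi_Fredholm_iff lower_semi_Fredholm_iff bounded_operator)
next
  assume "\<not> semi_Fredholm T"
  then have T: "\<not> cofinitely_bounded_below T" "\<not> cofinitely_bounded_below (cadjoint T)"
    by (simp_all add: semi_Fredholm_def upper_semi_Fredholm_iff lower_semi_Fredholm_iff bounded_operator)
  obtain U :: "'a set" where U: "countable U" "closure U = UNIV"
    using separable by (auto simp: separable_space_def)
  then have "U \<noteq> {}"
    by auto
  then have "range (from_nat_into U) = U"
    using U(1) by (rule range_from_nat_into)
  then obtain e f m where "staircase_basis T e f m"
    using exists_staircase_basis[OF bounded_operator T, of "from_nat_into U"] U(2) by metis
  then interpret staircase_basis T e f m .
  \<comment> \<open>Supplies the nonzero vector that puts 0 into both spectra.\<close>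
  have "e 0 \<noteq> 0"
    using norm_e[of 0] by auto
  then have "quasinilpotent Q1" "quasinilpotent Q2"
    by (auto intro: quasinilpotentI bounded_clinear_Q1 bounded_clinear_Q2 power_decay_Q1 power_decay_Q2)
  then show "\<exists>Q1 Q2. quasinilpotent Q1 \<and> quasinilpotent Q2 \<and> T = Q1 \<circ> Q2"
    using factorization by blast
qed
end
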